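(* Let $n\ge 2$ and $l\ge 1$ be integers and let $M(z,\bar z)$ be a non-zero bihomogeneous Hermitian polynomial of bidegree $(d,d)$ on $\mathbb C^n$ with signature $(p,q)$. Suppose $M(z,\bar z)\|z\|^{2l}$ is a sum of squared norms. Then $$q\le p\binom{n-1+l}{l}-p-p_{(n-1)}|_{-1}^{l-1}.$$ In particular, when $l=1$, $$q\le p(n-1)-p_{(n-1)}|_{-1}^{0}.$$
   Context: Here $\|z\|^2=|z_1|^2+\cdots+|z_n|^2$. A polynomial $M(z,\bar z)\in\mathbb C[z_1,\dots,z_n,\bar z_1,\dots,\bar z_n]$ is Hermitian if it is real-valued, and bihomogeneous of bidegree $(d,d)$ if it is homogeneous of degree $d$ in $z$ and of degree $d$ in $\bar z$. Such an $M$ can be written $M(z,\bar z)=Z_d^H\mathcal M Z_d$ with $Z_d$ the vector of all monomials of degree $d$ in $z$ and $\mathcal M$ a Hermitian matrix. The signature $(p,q)$ of $M$ is the pair (number of positive eigenvalues, number of negative eigenvalues) of $\mathcal M$; equivalently $M=|m_1|^2+\cdots+|m_p|^2-|m_{p+1}|^2-\cdots-|m_{p+q}|^2$ with linearly independent holomorphic polynomials $m_i(z)$. "$F(z,\bar z)$ is a sum of squared norms" means $F=|h_1|^2+\cdots+|h_R|^2$ for some holomorphic polynomials $h_i(z)$. Macaulay representation: for positive integers $A$ and $N$ there exist a unique integer $\delta$ with $1\le\delta\le N$ and unique integers $a_N>a_{N-1}>\cdots>a_\delta>0$ with $a_j\ge j$ for every $j$ such that $A=\binom{a_N}{N}+\cdots+\binom{a_\delta}{\delta}$.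 For integers $\sigma,\tau$ define $A_{(N)}|_\sigma^\tau=\binom{a_N+\tau}{N+\sigma}+\cdots+\binom{a_\delta+\tau}{\delta+\sigma}$ (lower index shifts the bottom entries, upper index the top entries). Convention: $0_{(N)}|_\sigma^\tau=0$. *)

theory Defs
  imports
    "Jordan_Normal_Form.Char_Poly"
    "HOL-Library.Poly_Mapping"
    "HOL-Library.Product_Plus"
begin

text \<open>A monomial in the variables \<open>z\<^sub>0, z\<^sub>1, \<dots>\<close> is its exponent vector; polynomials on \<open>\<complex>\<^sup>n\<close> use the
  variables with index \<open>< n\<close> only. The types \<open>hpoly\<close> and \<open>mixed_poly\<close> are polynomial rings with the
  convolution product of \<open>HOL-Library.Poly_Mapping\<close>. In \<open>mixed_poly\<close> the exponent pair
  \<open>(\<alpha>, \<beta>)\<close> stands for the monomial that is \<open>z\<close> to the \<open>\<alpha>\<close> times conjugate \<open>z\<close> to the \<open>\<beta>\<close>.\<close>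

type_synonym monomial = "nat \<Rightarrow>\<^sub>0 nat"
type_synonym hpoly = "monomial \<Rightarrow>\<^sub>0 complex"
type_synonym mixed_poly = "(monomial \<times> monomial) \<Rightarrow>\<^sub>0 complex"

definition monom_deg :: "monomial \<Rightarrow> nat" where
  "monom_deg \<alpha> = (\<Sum>i\<in>Poly_Mapping.keys \<alpha>. Poly_Mapping.lookup \<alpha> i)"

definition monom_eval :: "monomial \<Rightarrow> (nat \<Rightarrow> complex) \<Rightarrow> complex" where
  "monom_eval \<alpha> z = (\<Prod>i\<in>Poly_Mapping.keys \<alpha>. z i ^ Poly_Mapping.lookup \<alpha> i)"

definition hpoly_on :: "nat \<Rightarrow> hpoly \<Rightarrow> bool" where
  "hpoly_on n h \<longleftrightarrow> (\<forall>\<alpha>\<in>Poly_Mapping.keys h. Poly_Mapping.keys \<alpha> \<subseteq> {..<n})"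

definition hpoly_eval :: "hpoly \<Rightarrow> (nat \<Rightarrow> complex) \<Rightarrow> complex" where
  "hpoly_eval h z = (\<Sum>\<alpha>\<in>Poly_Mapping.keys h. Poly_Mapping.lookup h \<alpha> * monom_eval \<alpha> z)"

definition mixed_poly_on :: "nat \<Rightarrow> mixed_poly \<Rightarrow> bool" where
  "mixed_poly_on n M \<longleftrightarrow>
     (\<forall>(\<alpha>, \<beta>)\<in>Poly_Mapping.keys M. Poly_Mapping.keys \<alpha> \<subseteq> {..<n} \<and> Poly_Mapping.keys \<beta> \<subseteq> {..<n})"

definition mixed_eval :: "mixed_poly \<Rightarrow> (nat \<Rightarrow> complex) \<Rightarrow> complex" where
  "mixed_eval M z =
     (\<Sum>(\<alpha>, \<beta>)\<in>Poly_Mapping.keys M.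
        Poly_Mapping.lookup M (\<alpha>, \<beta>) * monom_eval \<alpha> z * cnj (monom_eval \<beta> z))"

definition hermitian_poly :: "mixed_poly \<Rightarrow> bool" where
  "hermitian_poly M \<longleftrightarrow> (\<forall>z. mixed_eval M z \<in> \<real>)"

definition bihomogeneous :: "nat \<Rightarrow> mixed_poly \<Rightarrow> bool" where
  "bihomogeneous d M \<longleftrightarrow> (\<forall>(\<alpha>, \<beta>)\<in>Poly_Mapping.keys M. monom_deg \<alpha> = d \<and> monom_deg \<beta> = d)"

text \<open>The polynomial \<open>\<parallel>z\<parallel>\<^sup>2\<close> on \<open>\<complex>\<^sup>n\<close>.\<close>

definition norm_sq_poly :: "nat \<Rightarrow> mixed_poly" where
  "norm_sq_poly n =
     (\<Sum>i<n. Poly_Mapping.single (Poly_Mapping.single i 1, Poly_Mapping.single i 1) 1)"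

definition sum_of_squared_norms :: "nat \<Rightarrow> mixed_poly \<Rightarrow> bool" where
  "sum_of_squared_norms n F \<longleftrightarrow>
     (\<exists>R (h :: nat \<Rightarrow> hpoly). (\<forall>k<R. hpoly_on n (h k)) \<and>
        (\<forall>z. mixed_eval F z = complex_of_real (\<Sum>k<R. (cmod (hpoly_eval (h k) z))\<^sup>2)))"

text \<open>The vector of all monomials of degree \<open>d\<close> in \<open>n\<close> variables is listed in increasing order with
  respect to the linear order on \<open>poly_mapping\<close>; the choice of the order does not affect the
  signature.\<close>

definition monomials :: "nat \<Rightarrow> nat \<Rightarrow> monomial list" where
  "monomials n d = sorted_list_of_set {\<alpha>. Poly_Mapping.keys \<alpha> \<subseteq> {..<n} \<and> monom_deg \<alpha> = d}"

text \<open>In \<open>Z\<^sup>H A Z\<close> the row index belongs to the conjugated monomial.\<close>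

definition coeff_matrix :: "nat \<Rightarrow> nat \<Rightarrow> mixed_poly \<Rightarrow> complex mat" where
  "coeff_matrix n d M =
     (let ms = monomials n d
      in mat (length ms) (length ms) (\<lambda>(i, j). Poly_Mapping.lookup M (ms ! j, ms ! i)))"

text \<open>Eigenvalues are counted with multiplicity.\<close>

definition num_pos_eigenvalues :: "complex mat \<Rightarrow> nat" where
  "num_pos_eigenvalues A =
     (\<Sum>x \<in> {x::real. x > 0 \<and> eigenvalue A (complex_of_real x)}.
        Polynomial.order (complex_of_real x) (char_poly A))"

definition num_neg_eigenvalues :: "complex mat \<Rightarrow> nat" where
  "num_neg_eigenvalues A =
     (\<Sum>x \<in> {x::real. x < 0 \<and> eigenvalue A (complex_of_real x)}.
        Polynomial.order (complex_of_real x) (char_poly A))"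

definition signature :: "nat \<Rightarrow> nat \<Rightarrow> mixed_poly \<Rightarrow> nat \<times> nat" where
  "signature n d M =
     (num_pos_eigenvalues (coeff_matrix n d M), num_neg_eigenvalues (coeff_matrix n d M))"

text \<open>Only the values of \<open>a\<close> on \<open>{\<delta>..N}\<close> are relevant.\<close>

definition macaulay_rep :: "nat \<Rightarrow> nat \<Rightarrow> nat \<Rightarrow> (nat \<Rightarrow> nat) \<Rightarrow> bool" where
  "macaulay_rep A N \<delta> a \<longleftrightarrow>
     1 \<le> \<delta> \<and> \<delta> \<le> N \<and> strict_mono_on {\<delta>..N} a \<and> 0 < a \<delta> \<and> (\<forall>j\<in>{\<delta>..N}. j \<le> a j) \<and>
     A = (\<Sum>j=\<delta>..N. a j choose j)"

text \<open>Shifted entries may be negative; a binomial coefficient with a negative entry is read as \<open>0\<close>.\<close>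

definition int_choose :: "int \<Rightarrow> int \<Rightarrow> int" where
  "int_choose a b = (if 0 \<le> a \<and> 0 \<le> b then int (nat a choose nat b) else 0)"

text \<open>\<open>macaulay_shift A N \<sigma> \<tau>\<close> is \<open>A\<^bsub>(N)\<^esub>\<close> with the lower shift \<open>\<sigma>\<close> (bottom entries) and the upper
  shift \<open>\<tau>\<close> (top entries). The description is well-defined for \<open>A, N > 0\<close> by existence and
  uniqueness of the Macaulay representation.\<close>

definition macaulay_shift :: "nat \<Rightarrow> nat \<Rightarrow> int \<Rightarrow> int \<Rightarrow> int" where
  "macaulay_shift A N \<sigma> \<tau> =
     (if A = 0 then 0
      else (THE v. \<exists>\<delta> a. macaulay_rep A N \<delta> a \<and>
              v = (\<Sum>j=\<delta>..N. int_choose (int (a j) + \<tau>) (int j + \<sigma>))))"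

end

theory Submission
  imports Defs "Jordan_Normal_Form.Jordan_Normal_Form_Existence"
begin

text \<open>Write \<open>M = |f\<^sub>1|\<^sup>2 + \<dots> + |f\<^sub>p|\<^sup>2 - |g\<^sub>1|\<^sup>2 - \<dots> - |g\<^sub>q|\<^sup>2\<close>. A linear functional on polynomials of
  degree \<open>d + l\<close> that kills all products of monomials of degree \<open>l\<close> with the \<open>f\<^sub>i\<close> makes the Hermitian form of
  \<open>M \<parallel>z\<parallel>\<^sup>2\<^sup>l\<close> nonpositive; as this form is also nonnegative, the functional kills the products with
  the \<open>g\<^sub>j\<close> too. So degree \<open>l\<close> multiples of the \<open>(p + q)\<close>-dimensional span of all \<open>f\<^sub>i\<close> and \<open>g\<^sub>j\<close>
  form a space of dimension at most \<open>p\<close> times the number of monomials of degree \<open>l\<close>. Passing to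
  trailing monomials, Macaulay's theorem bounds the dimension of this space from below: the first
  \<open>l - 1\<close> multiplications do not decrease a dimension that is at least \<open>p + q\<close>, and the last one
  adds at least the shifted Macaulay sum of \<open>p\<close>.\<close>

subsection \<open>Monomials of fixed degree and their shadows\<close>

text \<open>The hypothesis speaks of values at points, while the argument evaluates Hermitian forms
  at linear functionals that need not be point evaluations. The bridge is the linear independence of
  the monomials in z and its conjugate: a pointwise identity is an identity of coefficients and can
  then be read at any functional. Macaulay's theorem is used in a version whose lower binomial
  indices are bounded by the number of variables, not by the degree. Hence the representation has
  index n - 1 and the bound does not depend on d. The growth term belongs to p although the space
  has dimension p + q; so q enters just once, and p + q plus the growth term is at most p times the
  number of monomials of degree l.\<close>

abbreviation var :: "nat \<Rightarrow> monomial" where "var i \<equiv> Poly_Mapping.single i (Suc 0)"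

abbreviation lookup :: "('a \<Rightarrow>\<^sub>0 'b::zero) \<Rightarrow> 'a \<Rightarrow> 'b" where "lookup \<equiv> Poly_Mapping.lookup"

definition mons :: "nat \<Rightarrow> nat \<Rightarrow> monomial set" where
  "mons n d = {\<alpha>. Poly_Mapping.keys \<alpha> \<subseteq> {..<n} \<and> monom_deg \<alpha> = d}"

text \<open>Multiplying monomials means adding exponent vectors, so for \<open>E\<close> in a single
  degree this is the next degree of the monomial ideal generated by \<open>E\<close>.\<close>

definition shadow :: "nat \<Rightarrow> monomial set \<Rightarrow> monomial set" where
  "shadow n E = (\<Union>i<n. (\<lambda>x. x + var i) ` E)"

lemma monom_deg_superset:
  assumes "finite S" "Poly_Mapping.keys \<alpha> \<subseteq> S"
  shows "monom_deg \<alpha> = (\<Sum>i\<in>S. lookup \<alpha> i)"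
  unfolding monom_deg_def
  by (rule sum.mono_neutral_left) (use assms in \<open>auto simp: in_keys_iff\<close>)

lemma monom_deg_add: "monom_deg (\<alpha> + \<beta>) = monom_deg \<alpha> + monom_deg \<beta>"
proof -
  let ?S = "Poly_Mapping.keys \<alpha> \<union> Poly_Mapping.keys \<beta>"
  have "monom_deg \<gamma> = (\<Sum>i\<in>?S. lookup \<gamma> i)" if "Poly_Mapping.keys \<gamma> \<subseteq> ?S" for \<gamma>
    by (rule monom_deg_superset) (use that in auto)
  from this[of \<alpha>] this[of \<beta>] this[of "\<alpha> + \<beta>"] keys_add[of \<alpha> \<beta>]
  show ?thesis by (simp add: lookup_add sum.distrib)
qed

lemma monom_deg_var [simp]: "monom_deg (var i) = 1"
  by (simp add: monom_deg_def)

lemma mons_lookup: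
  "\<alpha> \<in> mons n d \<longleftrightarrow> (\<forall>i\<ge>n. lookup \<alpha> i = 0) \<and> (\<Sum>i<n. lookup \<alpha> i) = d"
proof -
  have "Poly_Mapping.keys \<alpha> \<subseteq> {..<n} \<longleftrightarrow> (\<forall>i\<ge>n. lookup \<alpha> i = 0)"
    by (auto simp: in_keys_iff subset_iff) (metis leI not_gr_zero)
  moreover have "monom_deg \<alpha> = (\<Sum>i<n. lookup \<alpha> i)" if "Poly_Mapping.keys \<alpha> \<subseteq> {..<n}"
    using that by (intro monom_deg_superset) auto
  ultimately show ?thesis by (auto simp: mons_def)
qed

lemma mons_add: "\<alpha> \<in> mons n d \<Longrightarrow> \<beta> \<in> mons n e \<Longrightarrow> \<alpha> + \<beta> \<in> mons n (d + e)"
  using keys_add[of \<alpha> \<beta>] by (auto simp: mons_def monom_deg_add)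

lemma var_mons: "i < n \<Longrightarrow> var i \<in> mons n 1"
  by (simp add: mons_def)

lemma mons_0 [simp]: "mons n 0 = {0}"
proof -
  have "\<alpha> = 0" if "\<alpha> \<in> mons n 0" for \<alpha>
  proof (rule poly_mapping_eqI)
    fix i show "lookup \<alpha> i = lookup 0 i"
      using that by (cases "i < n") (auto simp: mons_lookup)
  qed
  then show ?thesis by (auto simp: mons_lookup)
qed

lemma shadow_mons: "E \<subseteq> mons n d \<Longrightarrow> shadow n E \<subseteq> mons n (Suc d)"
  using mons_add[OF _ var_mons] by (fastforce simp: shadow_def)

lemma finite_shadow: "finite E \<Longrightarrow> finite (shadow n E)"
  by (simp add: shadow_def)

lemma var_split: "lookup x i > 0 \<Longrightarrow> \<exists>y. x = y + var i" for x :: monomial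
proof
  assume "lookup x i > 0"
  then show "x = (x - var i) + var i"
    by (auto simp: poly_mapping_eq_iff fun_eq_iff lookup_add lookup_minus lookup_single when_def)
qed

lemma shadow_mons_all: "shadow n (mons n d) = mons n (Suc d)"
proof (intro equalityI shadow_mons subset_refl subsetI)
  fix x assume x: "x \<in> mons n (Suc d)"
  then have "(\<Sum>i<n. lookup x i) \<noteq> 0" by (simp add: mons_lookup)
  then obtain i where i: "i < n" "lookup x i > 0" by (meson bot_nat_0.not_eq_extremum lessThan_iff sum.neutral)
  then obtain y where y: "x = y + var i" using var_split by blast
  have "y \<in> mons n d"
    using x keys_add[of y "var i"] unfolding y mons_def
    by (auto simp: monom_deg_add in_keys_iff lookup_add subset_iff)
  then show "x \<in> shadow n (mons n d)" using i y by (auto simp: shadow_def)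
qed

lemma finite_mons: "finite (mons n d)"
  by (induction d) (simp_all flip: shadow_mons_all add: finite_shadow)

lemma mons_Suc_Suc:
  "mons (Suc n) (Suc d) = mons n (Suc d) \<union> (\<lambda>x. x + var n) ` mons (Suc n) d"
proof (intro equalityI subsetI)
  fix x assume x: "x \<in> mons (Suc n) (Suc d)"
  show "x \<in> mons n (Suc d) \<union> (\<lambda>x. x + var n) ` mons (Suc n) d"
  proof (cases "lookup x n = 0")
    case True
    then have "x \<in> mons n (Suc d)" using x unfolding mons_lookup by (auto simp: le_eq_less_or_eq) (metis Suc_leI le_eq_less_or_eq)
    then show ?thesis by simp
  next
    case False
    then obtain y where y: "x = y + var n" using var_split by blast
    have "y \<in> mons (Suc n) d"
      using x keys_add[of y "var n"] unfolding y mons_def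
      by (auto simp: monom_deg_add in_keys_iff lookup_add subset_iff)
    then show ?thesis using y by auto
  qed
next
  fix x assume "x \<in> mons n (Suc d) \<union> (\<lambda>x. x + var n) ` mons (Suc n) d"
  then show "x \<in> mons (Suc n) (Suc d)"
    using mons_add[OF _ var_mons[of n "Suc n"]] by (auto simp: mons_lookup)
qed

text \<open>Pascal's rule: a monomial either avoids the last variable or is divisible by it. The
  count enters as an upper bound on the number of linear conditions, hence the inequality.\<close>

lemma card_mons_le: "card (mons (Suc n) l) \<le> (n + l) choose l"
proof (induction "n + l" arbitrary: n l rule: less_induct)
  case less
  show ?case
  proof (cases l)
    case 0
    then show ?thesis by simp
  next
    case (Suc k)
    have *: "card (mons n (Suc k)) \<le> (n + k) choose (Suc k)"
    proof (cases n)
      case 0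
      then have "mons n (Suc k) = {}" by (auto simp: mons_lookup)
      then show ?thesis by simp
    next
      case (Suc m)
      show ?thesis using less[of m "Suc k"] Suc \<open>l = Suc k\<close> by simp
    qed
    have "card (mons (Suc n) l) \<le> card (mons n (Suc k)) + card ((\<lambda>x. x + var n) ` mons (Suc n) k)"
      unfolding Suc mons_Suc_Suc by (rule card_Un_le)
    also have "\<dots> \<le> ((n + k) choose (Suc k)) + ((n + k) choose k)"
      using * less[of n k] card_image_le[OF finite_mons, of "\<lambda>x. x + var n" "Suc n" k] Suc
      by (intro add_mono) (auto intro: order_trans)
    finally show ?thesis using Suc by simp
  qed
qed

subsection \<open>Compression\<close>

text \<open>The elements of \<open>T\<close> beyond the initial segment and the gaps inside it are
  equally many, and each of the former exceeds each of the latter.\<close>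

lemma sum_lessThan_card_less:
  fixes T :: "nat set"
  assumes "finite T" "T \<noteq> {..<card T}"
  shows "\<Sum>{..<card T} < \<Sum>T"
proof -
  let ?K = "{..<card T}"
  have c: "card (T - ?K) = card (?K - T)"
    by (metis assms(1) card_lessThan card_Diff_subset_Int finite_Int finite_lessThan inf_commute)
  have ne: "?K - T \<noteq> {}"
    using assms by (metis Diff_eq_empty_iff card_lessThan card_subset_eq)
  have fK: "finite (?K - T)" by simp
  have "\<Sum>(?K - T) < (\<Sum>x\<in>?K - T. card T)"
    by (rule sum_strict_mono) (use ne in auto)
  also have "\<dots> = (\<Sum>x\<in>T - ?K. card T)" by (simp add: c)
  also have "\<dots> \<le> \<Sum>(T - ?K)" by (rule sum_mono) auto
  finally have "\<Sum>(?K - T) < \<Sum>(T - ?K)" .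
  moreover have "\<Sum>T = \<Sum>(T \<inter> ?K) + \<Sum>(T - ?K)" by (rule sum.Int_Diff[OF assms(1)])
  moreover have "\<Sum>?K = \<Sum>(T \<inter> ?K) + \<Sum>(?K - T)"
    by (subst sum.Int_Diff[of ?K _ T]) (auto simp: Int_commute)
  ultimately show ?thesis by linarith
qed

text \<open>\<open>fkey i m\<close> moves all powers of the variable \<open>m\<close> to \<open>i\<close>. Compression replaces each of its fibres
  by the same number of monomials with the smallest exponents of \<open>m\<close>; a fibre of a set of
  monomials of fixed degree is never too short for this.\<close>

definition fkey :: "nat \<Rightarrow> nat \<Rightarrow> monomial \<Rightarrow> monomial" where
  "fkey i m x = Poly_Mapping.update m 0 (Poly_Mapping.update i (lookup x i + lookup x m) x)"

definition fibre :: "nat \<Rightarrow> nat \<Rightarrow> monomial set \<Rightarrow> monomial \<Rightarrow> monomial set" where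
  "fibre i m E u = {x \<in> E. fkey i m x = u}"

definition compress :: "nat \<Rightarrow> nat \<Rightarrow> monomial set \<Rightarrow> monomial set" where
  "compress i m E = {y. lookup y m < card (fibre i m E (fkey i m y))}"

lemma fkey_eq_iff:
  assumes "i \<noteq> m"
  shows "fkey i m x = u \<longleftrightarrow> lookup u m = 0 \<and> lookup u i = lookup x i + lookup x m \<and>
    (\<forall>j. j \<noteq> i \<longrightarrow> j \<noteq> m \<longrightarrow> lookup u j = lookup x j)"
  using assms by (auto simp: fkey_def poly_mapping_eq_iff fun_eq_iff lookup_update)

lemma lookup_fkey:
  assumes "i \<noteq> m"
  shows "lookup (fkey i m x) j = (if j = m then 0 else if j = i then lookup x i + lookup x m else lookup x j)"
  using assms by (auto simp: fkey_def lookup_update)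

lemma fkey_eq_fkey_iff:
  assumes "i \<noteq> m"
  shows "fkey i m x = fkey i m y \<longleftrightarrow> lookup x i + lookup x m = lookup y i + lookup y m \<and>
    (\<forall>j. j \<noteq> i \<longrightarrow> j \<noteq> m \<longrightarrow> lookup x j = lookup y j)"
  using assms by (auto simp: fkey_eq_iff lookup_fkey)

lemma fkey_add:
  assumes "i \<noteq> m" "fkey i m x = fkey i m y" "fkey i m a = fkey i m b"
  shows "fkey i m (x + a) = fkey i m (y + b)"
  using assms by (simp add: fkey_eq_fkey_iff lookup_add)

text \<open>Along a fibre the exponents of \<open>i\<close> and \<open>m\<close> have a constant sum
  and all others are constant, so a fibre amounts to a set of natural numbers.\<close>

lemma inj_on_fibre: "i \<noteq> m \<Longrightarrow> inj_on (\<lambda>x. lookup x m) (fibre i m E u)"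
proof (rule inj_onI)
  fix x y assume "i \<noteq> m" "x \<in> fibre i m E u" "y \<in> fibre i m E u" and m: "lookup x m = lookup y m"
  then have k: "fkey i m x = fkey i m y" by (simp add: fibre_def)
  show "x = y"
  proof (rule poly_mapping_eqI)
    fix j show "lookup x j = lookup y j"
      using k m \<open>i \<noteq> m\<close> by (cases "j = i"; cases "j = m") (auto simp: fkey_eq_fkey_iff)
  qed
qed

lemma fibre_image_le: "i \<noteq> m \<Longrightarrow> (\<lambda>x. lookup x m) ` fibre i m E u \<subseteq> {..lookup u i}"
  by (auto simp: fibre_def fkey_eq_iff)

lemma finite_fibre: "i \<noteq> m \<Longrightarrow> finite (fibre i m E u)"
  using finite_imageD[OF finite_subset[OF fibre_image_le] inj_on_fibre] by blast

lemma card_fibre_le: "i \<noteq> m \<Longrightarrow> card (fibre i m E u) \<le> Suc (lookup u i)"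
  using card_mono[OF finite_atMost fibre_image_le[of i m E u]] by (simp add: card_image inj_on_fibre)

lemma fibre_compress:
  assumes "i \<noteq> m"
  shows "(\<lambda>x. lookup x m) ` fibre i m (compress i m E) u = {..<card (fibre i m E u)}"
proof (intro equalityI subsetI)
  fix t assume "t \<in> {..<card (fibre i m E u)}"
  then have t: "t < card (fibre i m E u)" by simp
  then obtain x where x: "fkey i m x = u" by (fastforce simp: fibre_def)
  define y where "y = Poly_Mapping.update m t (Poly_Mapping.update i (lookup u i - t) u)"
  \<comment> \<open>This keeps the truncated subtraction in \<open>y\<close> exact, so that the sum
    of the two exponents is unchanged.\<close>
  have "t \<le> lookup u i" using t card_fibre_le[OF assms, of E u] by linarith
  then have "fkey i m y = u"
    using assms x by (auto simp: fkey_eq_iff y_def lookup_update)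
  moreover have "lookup y m = t" by (simp add: y_def lookup_update)
  ultimately have "y \<in> fibre i m (compress i m E) u"
    using t by (auto simp: fibre_def compress_def)
  then show "t \<in> (\<lambda>x. lookup x m) ` fibre i m (compress i m E) u"
    using \<open>lookup y m = t\<close> by blast
qed (auto simp: fibre_def compress_def)

lemma card_fibre_compress:
  assumes "i \<noteq> m" shows "card (fibre i m (compress i m E) u) = card (fibre i m E u)"
  by (metis assms card_image card_lessThan fibre_compress inj_on_fibre)

lemma compress_key_nonempty:
  assumes "y \<in> compress i m E" shows "\<exists>x\<in>E. fkey i m x = fkey i m y"
proof -
  have "fibre i m E (fkey i m y) \<noteq> {}" using assms by (auto simp: compress_def)
  then show ?thesis by (auto simp: fibre_def)
qed

lemma finite_compress:
  assumes "i \<noteq> m" "finite E" shows "finite (compress i m E)"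
proof -
  have "compress i m E \<subseteq> (\<Union>u\<in>fkey i m ` E. fibre i m (compress i m E) u)"
    using compress_key_nonempty by (fastforce simp: fibre_def)
  then show ?thesis by (rule finite_subset) (use assms finite_fibre in auto)
qed

lemma sum_fibres:
  assumes "finite F" "fkey i m ` F \<subseteq> T" "finite T"
  shows "(\<Sum>u\<in>T. \<Sum>x\<in>fibre i m F u. h x) = sum h F"
  unfolding fibre_def by (rule sum.group) (use assms in auto)

lemma compress_keys: "fkey i m ` compress i m E \<subseteq> fkey i m ` E"
proof
  fix u assume "u \<in> fkey i m ` compress i m E"
  then obtain y where "y \<in> compress i m E" "u = fkey i m y" by blast
  with compress_key_nonempty[OF this(1)] show "u \<in> fkey i m ` E" by (metis imageI)
qed

lemma card_compress:
  assumes "i \<noteq> m" "finite E" shows "card (compress i m E) = card E"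
proof -
  have "card (compress i m E) = (\<Sum>u\<in>fkey i m ` E. card (fibre i m (compress i m E) u))"
    unfolding card_eq_sum
    by (rule sum_fibres[symmetric]) (use finite_compress[OF assms] compress_keys assms in auto)
  also have "\<dots> = (\<Sum>u\<in>fkey i m ` E. card (fibre i m E u))"
    by (simp add: card_fibre_compress assms)
  also have "\<dots> = card E"
    unfolding card_eq_sum by (rule sum_fibres) (use assms in auto)
  finally show ?thesis .
qed

text \<open>The total exponent of \<open>m\<close> is the potential that makes compression
  terminate: on each fibre an initial segment has the least sum among the sets of its size.\<close>

lemma sum_compress_less:
  assumes "i \<noteq> m" "finite E" "compress i m E \<noteq> E"
  shows "(\<Sum>x\<in>compress i m E. lookup x m) < (\<Sum>x\<in>E. lookup x m)"
proof -
  let ?C = "compress i m E" and ?l = "\<lambda>x::monomial. lookup x m"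
  have s: "sum ?l (fibre i m F u) = \<Sum>(?l ` fibre i m F u)" for F u
    by (simp add: sum.reindex inj_on_fibre assms)
  have le: "sum ?l (fibre i m ?C u) \<le> sum ?l (fibre i m E u)
      \<and> (?l ` fibre i m E u \<noteq> ?l ` fibre i m ?C u \<longrightarrow> sum ?l (fibre i m ?C u) < sum ?l (fibre i m E u))" for u
  proof -
    have "card (fibre i m E u) = card (?l ` fibre i m E u)"
      by (simp add: card_image inj_on_fibre assms)
    then show ?thesis
      unfolding s fibre_compress[OF assms(1)]
      using sum_lessThan_card_less[of "?l ` fibre i m E u"] finite_fibre[OF assms(1), of E u]
      by (metis finite_imageI order_le_less)
  qed
  have "\<exists>u\<in>fkey i m ` E. ?l ` fibre i m E u \<noteq> ?l ` fibre i m ?C u"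
  proof (rule ccontr)
    assume "\<not> ?thesis"
    then have eq: "?l ` fibre i m E u = ?l ` fibre i m ?C u" if "u \<in> fkey i m ` E" for u
      using that by blast
    have "?C = E"
    proof (rule sym, rule card_subset_eq)
      show "finite ?C" by (rule finite_compress[OF assms(1,2)])
      show "card E = card ?C" by (simp add: card_compress assms)
      show "E \<subseteq> ?C"
      proof
        fix x assume x: "x \<in> E"
        then have "?l x \<in> ?l ` fibre i m E (fkey i m x)" by (auto simp: fibre_def)
        with eq[of "fkey i m x"] x fibre_compress[OF assms(1), of E]
        have "?l x < card (fibre i m E (fkey i m x))" by auto
        then show "x \<in> ?C" by (simp add: compress_def)
      qed
    qed
    with assms(3) show False by simp
  qed
  then have "(\<Sum>u\<in>fkey i m ` E. sum ?l (fibre i m ?C u)) < (\<Sum>u\<in>fkey i m ` E. sum ?l (fibre i m E u))"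
    using le assms(2) by (intro sum_strict_mono_ex1) blast+
  then show ?thesis
    using sum_fibres[OF finite_compress[OF assms(1,2)] compress_keys, of ?l]
      sum_fibres[OF assms(2) subset_refl, of i m ?l] assms(2) by simp
qed

lemma compress_mons:
  assumes "i < n" "m < n" "i \<noteq> m" "E \<subseteq> mons n d"
  shows "compress i m E \<subseteq> mons n d"
proof
  fix y assume "y \<in> compress i m E"
  then obtain x where x: "x \<in> E" and k: "fkey i m x = fkey i m y" using compress_key_nonempty by blast
  have sp: "(\<Sum>j<n. lookup z j) = (\<Sum>j\<in>{..<n} - {i, m}. lookup z j) + (lookup z i + lookup z m)" for z :: monomial
    using sum.subset_diff[of "{i,m}" "{..<n}" "lookup z"] assms by auto
  have "(\<Sum>j\<in>{..<n} - {i, m}. lookup x j) = (\<Sum>j\<in>{..<n} - {i, m}. lookup y j)"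
    using k assms by (intro sum.cong) (auto simp: fkey_eq_fkey_iff)
  moreover have "x \<in> mons n d" using x assms by auto
  ultimately show "y \<in> mons n d"
    using k assms unfolding mons_lookup sp by (auto simp: fkey_eq_fkey_iff)
qed

text \<open>Multiplication by a variable maps fibres into fibres. For a variable other than
  \<open>m\<close>, the translated fibre of \<open>y\<close> shows that the fibre of
  \<open>z\<close> is large enough, since the exponent of \<open>m\<close> stays the same. For
  \<open>m\<close> itself the exponent grows by one, so the fibre of \<open>z\<close> must have one
  element more.\<close>

lemma shadow_compress:
  assumes im: "i < n" "m < n" "i \<noteq> m" and "finite E"
  shows "shadow n (compress i m E) \<subseteq> compress i m (shadow n E)"
proof
  fix z assume "z \<in> shadow n (compress i m E)"
  then obtain j y where j: "j < n" and y: "y \<in> compress i m E" and z: "z = y + var j"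
    by (auto simp: shadow_def)
  let ?F = "fibre i m E (fkey i m y)" and ?U = "fibre i m (shadow n E) (fkey i m z)"
  have yl: "lookup y m < card ?F" using y by (simp add: compress_def)
  have sub: "(\<lambda>x. x + var k) ` ?F \<subseteq> ?U" if "k < n" "fkey i m (var k) = fkey i m (var j)" for k
  proof
    fix x assume "x \<in> (\<lambda>x. x + var k) ` ?F"
    then obtain w where w: "x = w + var k" "w \<in> E" "fkey i m w = fkey i m y"
      by (auto simp: fibre_def)
    then have "x \<in> shadow n E" using that(1) by (auto simp: shadow_def)
    then show "x \<in> ?U" using fkey_add[OF im(3) w(3) that(2)] w(1) z by (simp add: fibre_def)
  qed
  have cl: "card ?F \<le> card ?U" if "k < n" "fkey i m (var k) = fkey i m (var j)" for k
    using card_mono[OF finite_fibre[OF im(3)] sub[OF that]] by (simp add: card_image)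
  have "lookup z m < card ?U"
  proof (cases "j = m")
    case False
    then have "lookup z m = lookup y m" by (simp add: z lookup_add lookup_single)
    then show ?thesis using cl[OF j refl] yl by simp
  next
    case True
    let ?l = "\<lambda>x::monomial. lookup x m"
    have kim: "fkey i m (var i) = fkey i m (var j)"
      using im True by (auto simp: fkey_eq_fkey_iff lookup_single)
    let ?T = "?l ` ?F"
    have fin: "finite ?F" by (rule finite_fibre[OF im(3)])
    have ne: "?F \<noteq> {}" using yl by auto
    \<comment> \<open>Multiplying by \<open>i\<close> keeps all exponents of \<open>m\<close>;
      multiplying the element with the largest exponent by \<open>m\<close> supplies a new
      one.\<close>
    have "insert (Suc (Max ?T)) ?T \<subseteq> ?l ` ?U"
    proof -
      have "?T = ?l ` (\<lambda>x. x + var i) ` ?F"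
        using im by (auto simp: image_image lookup_add lookup_single)
      then have "?T \<subseteq> ?l ` ?U" using sub[OF im(1) kim] by blast
      moreover have "Max ?T \<in> ?T" using fin ne by (intro Max_in) auto
      then obtain x where x: "x \<in> ?F" "Max ?T = lookup x m" by blast
      have "x + var m \<in> ?U" using sub[OF j refl] x True by auto
      then have "Suc (Max ?T) \<in> ?l ` ?U"
        using x by (intro image_eqI[of _ _ "x + var m"]) (auto simp: lookup_add)
      ultimately show ?thesis by blast
    qed
    then have "card (insert (Suc (Max ?T)) ?T) \<le> card (?l ` ?U)"
      by (intro card_mono) (use finite_fibre[OF im(3)] in auto)
    also have "card (insert (Suc (Max ?T)) ?T) = Suc (card ?T)"
      using fin Max_ge[of ?T "Suc (Max ?T)"] by (intro card_insert_disjoint) (force simp del: Max_ge)+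
    finally have "Suc (card ?F) \<le> card ?U"
      using im by (simp add: card_image inj_on_fibre)
    moreover have "lookup z m = Suc (lookup y m)" using True by (simp add: z lookup_add)
    ultimately show ?thesis using yl by simp
  qed
  then show "z \<in> compress i m (shadow n E)" by (simp add: compress_def)
qed

text \<open>Among the sets of the same size with no larger shadow, one with the least total exponent
  of \<open>m\<close> is fixed by every compression. The fibres of a fixed set are initial segments,
  and trading one factor \<open>m\<close> for \<open>i\<close> moves down in a fibre.\<close>

lemma exists_stable:
  assumes m: "m < n" and E: "E \<subseteq> mons n d"
  shows "\<exists>E'\<subseteq>mons n d. card E' = card E \<and> card (shadow n E') \<le> card (shadow n E) \<and>
    (\<forall>y. \<forall>i<n. y + var m \<in> E' \<longrightarrow> y + var i \<in> E')"
proof -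
  define P where "P = (\<lambda>E'. E' \<subseteq> mons n d \<and> card E' = card E \<and> card (shadow n E') \<le> card (shadow n E))"
  have "P E" using E by (simp add: P_def)
  then obtain E' where E': "P E'" and
    least: "\<And>F. P F \<Longrightarrow> (\<Sum>x\<in>E'. lookup x m) \<le> (\<Sum>x\<in>F. lookup x m)"
    using ex_has_least_nat[of P E "\<lambda>F. \<Sum>x\<in>F. lookup x m"] by auto
  have fin: "finite E'" using E' finite_mons finite_subset unfolding P_def by blast
  have "y + var i \<in> E'" if i: "i < n" and y: "y + var m \<in> E'" for y i
  proof (cases "i = m")
    case False
    let ?C = "compress i m E'"
    have "card (shadow n ?C) \<le> card (compress i m (shadow n E'))"
      using False fin by (intro card_mono finite_compress finite_shadow shadow_compress i m) auto
    then have "P ?C"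
      using E' False i m fin compress_mons[of i n m E' d]
      by (simp add: P_def card_compress finite_shadow)
    then have "?C = E'" using least[of ?C] sum_compress_less[OF False fin] by linarith
    then have "lookup (y + var m) m < card (fibre i m E' (fkey i m (y + var m)))"
      using y by (auto simp: compress_def)
    moreover have "fkey i m (y + var m) = fkey i m (y + var i)"
      using False by (auto simp: fkey_eq_fkey_iff lookup_add lookup_single)
    ultimately have "y + var i \<in> ?C"
      using False by (simp add: compress_def lookup_add lookup_single)
    then show ?thesis using \<open>?C = E'\<close> by simp
  qed (use y in simp)
  then show ?thesis using E' unfolding P_def by blast
qed

subsection \<open>Macaulay's growth bound\<close>

text \<open>The set \<open>E\<close> is the disjoint union of \<open>E0\<close> and the multiples of
  \<open>E1\<close> by the last variable. The shadow of \<open>E0\<close> in the first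
  \<open>N\<close> variables and the multiples of \<open>E\<close> by the last variable are disjoint
  parts of the shadow of \<open>E\<close>. Stability says that multiplying \<open>E1\<close> by any
  variable stays in \<open>E\<close>.\<close>

lemma card_shadow_stable_ge:
  assumes E: "E \<subseteq> mons (Suc N) d"
    and stable: "\<And>y i. i < Suc N \<Longrightarrow> y + var N \<in> E \<Longrightarrow> y + var i \<in> E"
  defines "E0 \<equiv> {x \<in> E. lookup x N = 0}" and "E1 \<equiv> {y. y + var N \<in> E}"
  shows "card E = card E0 + card E1" "card E + card (shadow N E0) \<le> card (shadow (Suc N) E)"
    "card (shadow (Suc N) E1) \<le> card E" "E0 \<subseteq> mons N d" "E1 \<subseteq> mons (Suc N) (d - 1)" "d = 0 \<Longrightarrow> E1 = {}"
proof -
  have finE: "finite E" using E finite_mons finite_subset by blast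
  let ?s = "\<lambda>x. x + var N"
  have E_eq: "E = E0 \<union> ?s ` E1"
    using var_split[of _ N] by (force simp: E0_def E1_def)
  have fin0: "finite E0" using finE by (simp add: E0_def)
  have fin1: "finite E1"
  proof (rule finite_imageD)
    show "finite (?s ` E1)" by (rule finite_subset[OF _ finE]) (auto simp: E1_def)
    show "inj_on ?s E1" by simp
  qed
  have "E0 \<inter> ?s ` E1 = {}" by (auto simp: E0_def lookup_add)
  then show "card E = card E0 + card E1"
    by (subst E_eq) (simp add: card_Un_disjoint fin0 fin1 card_image)
  have "shadow (Suc N) E1 \<subseteq> E" using stable by (auto simp: shadow_def E1_def)
  then show "card (shadow (Suc N) E1) \<le> card E" using finE card_mono by blast
  have "shadow N E0 \<inter> ?s ` E = {}"
    by (auto simp: shadow_def E0_def lookup_add lookup_single dest!: arg_cong[where f = "\<lambda>x. lookup x N"])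
  moreover have "shadow N E0 \<union> ?s ` E \<subseteq> shadow (Suc N) E"
    by (auto simp: shadow_def E0_def less_Suc_eq)
  ultimately show "card E + card (shadow N E0) \<le> card (shadow (Suc N) E)"
    using card_mono[OF finite_shadow[OF finE], of "shadow N E0 \<union> ?s ` E" "Suc N"] finE fin0
    by (simp add: card_Un_disjoint finite_shadow card_image)
  show "E0 \<subseteq> mons N d"
  proof
    fix x assume x: "x \<in> E0"
    then have "x \<in> mons (Suc N) d" "lookup x N = 0" using E by (auto simp: E0_def)
    then show "x \<in> mons N d"
      unfolding mons_lookup by (auto simp: le_eq_less_or_eq) (metis Suc_leI le_eq_less_or_eq)
  qed
  have *: "y \<in> mons (Suc N) (d - 1) \<and> d > 0" if "y \<in> E1" for y
  proof -
    have "y + var N \<in> mons (Suc N) d" using that E by (auto simp: E1_def)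
    then show ?thesis
      by (auto simp: mons_def monom_deg_add in_keys_iff lookup_add subset_iff)
  qed
  show "E1 \<subseteq> mons (Suc N) (d - 1)" "d = 0 \<Longrightarrow> E1 = {}" using * by auto
qed

text \<open>The sequence \<open>c\<close> encodes a number in the combinatorial number system;
  it represents \<open>card E - 1\<close> in the sharp case, because a representation of \<open>card E\<close> itself would
  need an additional index \<open>\<delta>\<close>. After compression, either the slice \<open>E0\<close> without the last variable
  is large, or the quotient \<open>E1\<close> by the last variable is so large that its shadow exceeds \<open>E\<close>.\<close>

theorem card_shadow_ge:
  assumes "strict_mono c" "E \<subseteq> mons (Suc N) d" "(\<Sum>j<N. c j choose Suc j) < card E"
  shows "card E + (\<Sum>j<N. c j choose j) \<le> card (shadow (Suc N) E)"
  using assms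
proof (induction "N + d" arbitrary: N d E c rule: less_induct)
  case less
  obtain E' where E': "E' \<subseteq> mons (Suc N) d" "card E' = card E" "card (shadow (Suc N) E') \<le> card (shadow (Suc N) E)"
    and stable: "\<And>y i. i < Suc N \<Longrightarrow> y + var N \<in> E' \<Longrightarrow> y + var i \<in> E'"
    using exists_stable[of N "Suc N" E d] less.prems by (metis lessI)
  define E0 where "E0 = {x \<in> E'. lookup x N = 0}"
  define E1 where "E1 = {y. y + var N \<in> E'}"
  note slices = card_shadow_stable_ge[OF E'(1) stable, folded E0_def E1_def]
  have "card E' + (\<Sum>j<N. c j choose j) \<le> card (shadow (Suc N) E')"
  proof (cases N)
    case 0
    then show ?thesis using slices(2) by simp
  next
    case (Suc K)
    \<comment> \<open>Lowering the entries above \<open>c 0\<close> by one lets Pascal's rule split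
      the sum for \<open>c\<close>: the binomials with lower index \<open>j + 2\<close> are meant
      for \<open>E1\<close>, those with lower index \<open>j + 1\<close> for
      \<open>E0\<close>.\<close>
    define c' where "c' = (\<lambda>j. c (Suc j) - 1)"
    \<comment> \<open>The maximum keeps the sequence strictly increasing where
      \<open>c j = j\<close>; there the binomial over \<open>Suc j\<close> is zero before and after
      taking it.\<close>
    define e where "e = (\<lambda>j. max (c j - 1) j)"
    have cj: "j \<le> c j" for j using less.prems(1) by (rule strict_mono_imp_increasing)
    have cS: "c j < c (Suc j)" for j using less.prems(1) by (simp add: strict_mono_Suc_iff)
    have c': "strict_mono c'"
      unfolding strict_mono_Suc_iff c'_def using cS cj[of "Suc _"] by (metis Suc_le_lessD diff_less_mono less_nat_zero_code not_less_eq_eq One_nat_def Suc_leI zero_less_Suc order_less_le_trans)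
    have e: "strict_mono e"
      unfolding strict_mono_Suc_iff e_def
    proof
      fix j show "max (c j - 1) j < max (c (Suc j) - 1) (Suc j)"
        using cS[of j] by (auto simp: max_def)
    qed
    have c_pos: "c (Suc j) = Suc (c' j)" for j using cj[of "Suc j"] by (simp add: c'_def)
    have s1: "(\<Sum>j<N. c j choose Suc j) = c 0 + (\<Sum>j<K. c' j choose Suc (Suc j)) + (\<Sum>j<K. c' j choose Suc j)"
      by (simp add: Suc sum.lessThan_Suc_shift c_pos sum.distrib del: sum.lessThan_Suc)
    \<comment> \<open>The first two terms are the lower bound for \<open>card E0\<close> proved
      next; the last is the growth of \<open>E0\<close> in one variable fewer.\<close>
    have s2: "(\<Sum>j<N. c j choose j) = 1 + (\<Sum>j<K. c' j choose Suc j) + (\<Sum>j<K. c' j choose j)"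
      by (simp add: Suc sum.lessThan_Suc_shift c_pos sum.distrib del: sum.lessThan_Suc)
    have "card E0 \<ge> 1 + (\<Sum>j<K. c' j choose Suc j)"
    proof (rule ccontr)
      assume small: "\<not> ?thesis"
      then have "card E1 > c 0 + (\<Sum>j<K. c' j choose Suc (Suc j))"
        using less.prems(3) slices(1) E'(2) s1 by linarith
      moreover have "e (Suc j) choose Suc (Suc j) = c' j choose Suc (Suc j)" for j
        by (auto simp: e_def c'_def max_def binomial_eq_0)
      moreover have "e 0 \<le> c 0" by (simp add: e_def)
      ultimately have lt: "(\<Sum>j<N. e j choose Suc j) < card E1"
        by (simp add: Suc sum.lessThan_Suc_shift del: sum.lessThan_Suc)
      then have "d \<noteq> 0" using slices(6) by (metis card.empty not_less_zero)
      \<comment> \<open>The degree has dropped by one, so the induction applies. It will give the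
        shadow of \<open>E1\<close> more than \<open>card E1 + card E0\<close> elements, that is,
        more than the set in which stability places it.\<close>
      then have "card E1 + (\<Sum>j<N. e j choose j) \<le> card (shadow (Suc N) E1)"
        using less.hyps[of N "d - 1" e E1] e slices(5) lt by simp
      moreover have "(\<Sum>j<N. e j choose j) \<ge> 1 + (\<Sum>j<K. c' j choose Suc j)"
      proof -
        have "c' j choose Suc j \<le> e (Suc j) choose Suc j" for j
          by (rule binomial_right_mono) (simp add: e_def c'_def)
        then have "(\<Sum>j<K. c' j choose Suc j) \<le> (\<Sum>j<K. e (Suc j) choose Suc j)"
          by (rule sum_mono)
        then show ?thesis by (simp add: Suc sum.lessThan_Suc_shift del: sum.lessThan_Suc)
      qed
      ultimately show False using small slices(1,3) by linarith
    qed
    moreover from this have "card E0 + (\<Sum>j<K. c' j choose j) \<le> card (shadow N E0)"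
      using less.hyps[of K d c' E0] c' slices(4) Suc by simp
    ultimately show ?thesis using slices(2) s2 by linarith
  qed
  then show ?case using E' by linarith
qed

text \<open>By Pascal's rule the growth guaranteed for the entries \<open>c j + l\<close> is exactly
  the difference to the sum for \<open>c j + Suc l\<close>, so the hypothesis of
  \<open>card_shadow_ge\<close> reproduces itself from degree to degree.\<close>

lemma card_shadow_pow_ge:
  assumes c: "strict_mono c" and E: "E \<subseteq> mons (Suc N) d" "(\<Sum>j<N. c j choose Suc j) < card E"
  shows "(shadow (Suc N) ^^ l) E \<subseteq> mons (Suc N) (d + l)
    \<and> (\<Sum>j<N. (c j + l) choose Suc j) < card ((shadow (Suc N) ^^ l) E)
    \<and> card E \<le> card ((shadow (Suc N) ^^ l) E)"
proof (induction l)
  case 0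
  then show ?case using E by simp
next
  case (Suc l)
  let ?F = "(shadow (Suc N) ^^ l) E"
  have "strict_mono (\<lambda>j. c j + l)" using c by (simp add: strict_mono_Suc_iff)
  from card_shadow_ge[OF this, of ?F N "d + l"] Suc
  have *: "card ?F + (\<Sum>j<N. (c j + l) choose j) \<le> card (shadow (Suc N) ?F)" by simp
  have "(\<Sum>j<N. (c j + Suc l) choose Suc j) = (\<Sum>j<N. (c j + l) choose j) + (\<Sum>j<N. (c j + l) choose Suc j)"
    by (simp add: sum.distrib)
  then show ?case using * Suc shadow_mons[of ?F "Suc N" "d + l"] by simp
qed

text \<open>The summand is \<open>card E\<close> itself and not the number encoded by
  \<open>c\<close>: in the application \<open>c\<close> encodes \<open>p - 1\<close> while
  \<open>E\<close> has at least \<open>p + q\<close> elements. The first \<open>l\<close> shadows do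
  not lower \<open>card E\<close>, and the last one contributes the growth.\<close>

lemma card_shadow_pow_Suc_ge:
  assumes c: "strict_mono c" and E: "E \<subseteq> mons (Suc N) d" "(\<Sum>j<N. c j choose Suc j) < card E"
  shows "card E + (\<Sum>j<N. (c j + l) choose j) \<le> card ((shadow (Suc N) ^^ Suc l) E)"
proof -
  have "strict_mono (\<lambda>j. c j + l)" using c by (simp add: strict_mono_Suc_iff)
  from card_shadow_ge[OF this, of "(shadow (Suc N) ^^ l) E" N "d + l"] card_shadow_pow_ge[OF assms, of l]
  show ?thesis by simp
qed

subsection \<open>Inertia of Hermitian matrices\<close>

text \<open>Gaussian elimination, phrased for functions on arbitrary finite sets because later the
  equations are indexed by pairs and the unknowns by monomials.\<close>

lemma homogeneous_system_solvable:
  fixes c :: "'i \<Rightarrow> 'a \<Rightarrow> 'f::field"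
  assumes "finite I" "finite F" "card I < card F"
  shows "\<exists>\<phi>. (\<forall>i\<in>I. (\<Sum>x\<in>F. c i x * \<phi> x) = 0) \<and> (\<exists>x\<in>F. \<phi> x \<noteq> 0)"
  using assms
proof (induction I arbitrary: F c rule: finite_induct)
  case empty
  then have "F \<noteq> {}" by auto
  then show ?case by (intro exI[of _ "\<lambda>_. 1"]) auto
next
  case (insert i I)
  show ?case
  proof (cases "\<forall>x\<in>F. c i x = 0")
    case True
    have "card I < card F" using insert by simp
    with insert.IH[OF insert.prems(1), of c] True show ?thesis by fastforce
  next
    case False
    then obtain y where y: "y \<in> F" "c i y \<noteq> 0" by blast
    let ?F = "F - {y}"
    have "card I < card ?F" using insert y by simp
    with insert.IH[of ?F "\<lambda>j x. c j x - c j y * c i x / c i y"] insert.prems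
    obtain \<phi> x where \<phi>: "\<And>j. j \<in> I \<Longrightarrow> (\<Sum>x\<in>?F. (c j x - c j y * c i x / c i y) * \<phi> x) = 0"
      and x: "x \<in> ?F" "\<phi> x \<noteq> 0" by auto
    define \<psi> where "\<psi> = \<phi>(y := - (\<Sum>x\<in>?F. c i x * \<phi> x) / c i y)"
    have sum: "(\<Sum>x\<in>F. c j x * \<psi> x) = c j y * \<psi> y + (\<Sum>x\<in>?F. c j x * \<phi> x)" for j
      using y insert.prems by (subst sum.remove[of F y]) (auto simp: \<psi>_def)
    have "(\<Sum>x\<in>F. c j x * \<psi> x) = 0" if "j \<in> I" for j
    proof -
      have "(\<Sum>x\<in>?F. c j x * \<phi> x) - c j y / c i y * (\<Sum>x\<in>?F. c i x * \<phi> x) = 0"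
        using \<phi>[OF that] by (simp add: sum_distrib_left sum_subtractf algebra_simps)
      then show ?thesis unfolding sum by (simp add: \<psi>_def algebra_simps)
    qed
    moreover have "(\<Sum>x\<in>F. c i x * \<psi> x) = 0"
      unfolding sum using y by (simp add: \<psi>_def)
    moreover have "\<psi> x \<noteq> 0" using x by (simp add: \<psi>_def)
    ultimately show ?thesis using x by (intro exI[of _ \<psi>]) auto
  qed
qed

section \<open>Diagonalization of Hermitian matrices through the Jordan form\<close>

lemma jordan_matrix_entries:
  assumes "i < sum_list (map fst n_as)" "j < sum_list (map fst n_as)" "i \<noteq> j"
    and "jordan_matrix n_as $$ (i, j) \<noteq> 0"
  shows "j = Suc i \<and> jordan_matrix n_as $$ (i, i) = jordan_matrix n_as $$ (j, j)"
  using assms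
proof (induction n_as arbitrary: i j)
  case (Cons na n_as)
  obtain n a where na: "na = (n, a)" by force
  let ?s = "sum_list (map fst n_as)"
  have d: "dim_row (jordan_block n a) = n" "dim_col (jordan_block n a) = n" by (auto simp: jordan_block_def)
  show ?case
  proof (cases "i < n \<or> j < n")
    case True
    then show ?thesis
      using Cons.prems unfolding na jordan_matrix_Cons
      by (auto simp: d jordan_block_index split: if_splits)
  next
    case False
    then have "i - n < ?s" "j - n < ?s" "i - n \<noteq> j - n" using Cons.prems na by auto
    from Cons.IH[OF this] False show ?thesis
      using Cons.prems unfolding na jordan_matrix_Cons by (auto simp: d)
  qed
qed simp

lemma index_mult_mat_sum:
  assumes "A \<in> carrier_mat N N" "B \<in> carrier_mat N N" "i < N" "j < N"
  shows "(A * B) $$ (i, j) = (\<Sum>k<N. A $$ (i, k) * B $$ (k, j))"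
  using assms by (simp add: scalar_prod_def atLeast0LessThan)

lemma order_prod_list_linear:
  fixes as :: "'a::idom list"
  shows "Polynomial.order x (\<Prod>a\<leftarrow>as. [:- a, 1:]) = count_list as x"
proof (induction as)
  case (Cons a as)
  have "(\<Prod>a\<leftarrow>as. [:- a, 1:]) \<noteq> 0" by (auto simp: prod_list_zero_iff)
  then have "Polynomial.order x (\<Prod>a\<leftarrow>a # as. [:- a, 1:])
      = Polynomial.order x [:- a, 1:] + Polynomial.order x (\<Prod>a\<leftarrow>as. [:- a, 1:])"
    by (simp add: order_mult del: mult_pCons_left)
  then show ?case using Cons by (simp add: order_linear')
qed (simp add: order_0I)

text \<open>The order of a root is the number of positions carrying it, so grouping positions by
  value turns the sum into a count. The predicate \<open>S\<close> serves for both signs.\<close>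

lemma sum_order_eq_card:
  fixes A :: "complex mat" and d :: "nat \<Rightarrow> real"
  assumes "A \<in> carrier_mat N N" and cp: "char_poly A = (\<Prod>a\<leftarrow>map (\<lambda>k. complex_of_real (d k)) [0..<N]. [:- a, 1:])"
  shows "(\<Sum>x \<in> {x::real. S x \<and> eigenvalue A (complex_of_real x)}.
    Polynomial.order (complex_of_real x) (char_poly A)) = card {k. k < N \<and> S (d k)}"
proof -
  have count_map: "count_list (map (\<lambda>k. complex_of_real (d k)) ks) (complex_of_real x)
      = length (filter (\<lambda>k. d k = x) ks)" for ks x
    by (induction ks) auto
  have ord: "Polynomial.order (complex_of_real x) (char_poly A) = card {k \<in> {k. k < N \<and> S (d k)}. d k = x}" if "S x" for x
  proof -
    have "Polynomial.order (complex_of_real x) (char_poly A) = length (filter (\<lambda>k. d k = x) [0..<N])"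
      unfolding cp order_prod_list_linear count_map by simp
    also have "\<dots> = card {k. k < N \<and> d k = x}"
      by (auto simp: length_filter_conv_card intro!: arg_cong[of _ _ card])
    also have "{k. k < N \<and> d k = x} = {k \<in> {k. k < N \<and> S (d k)}. d k = x}" using that by auto
    finally show ?thesis .
  qed
  have ev: "eigenvalue A (complex_of_real x) \<longleftrightarrow> x \<in> d ` {..<N}" for x
    unfolding eigenvalue_root_char_poly[OF assms(1)] cp
    by (auto simp: poly_prod_list prod_list_zero_iff image_iff)
  have eq: "{x. S x \<and> eigenvalue A (complex_of_real x)} = d ` {k. k < N \<and> S (d k)}"
    unfolding ev by auto
  have "(\<Sum>x \<in> {x. S x \<and> eigenvalue A (complex_of_real x)}.
      Polynomial.order (complex_of_real x) (char_poly A))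
      = (\<Sum>x\<in>d ` {k. k < N \<and> S (d k)}. card {k \<in> {k. k < N \<and> S (d k)}. d k = x})"
    unfolding eq by (rule sum.cong) (auto simp: ord)
  also have "\<dots> = card {k. k < N \<and> S (d k)}"
    unfolding card_eq_sum by (rule sum.group) auto
  finally show ?thesis .
qed

text \<open>Let \<open>A P = P J\<close> with \<open>J\<close> in Jordan form and let
  \<open>G = P^H P\<close>. For Hermitian \<open>A\<close> this gives \<open>G J = J^H G\<close>,
  and since the diagonal of \<open>G\<close> is nonzero, \<open>J\<close> must be real and diagonal.
  The matrix \<open>P\<close> need not be unitary; the equation yields orthogonality between columns
  of different eigenvalues.\<close>

lemma hermitian_diagonalization:
  fixes A :: "complex mat"
  assumes A: "A \<in> carrier_mat N N" and herm: "\<And>i j. i < N \<Longrightarrow> j < N \<Longrightarrow> cnj (A $$ (i, j)) = A $$ (j, i)"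
  obtains P Q :: "nat \<Rightarrow> nat \<Rightarrow> complex" and d :: "nat \<Rightarrow> real" where
    "\<And>i j. i < N \<Longrightarrow> j < N \<Longrightarrow> (\<Sum>k<N. A $$ (i, k) * P k j) = P i j * d j"
    "\<And>i j. i < N \<Longrightarrow> j < N \<Longrightarrow> (\<Sum>k<N. Q i k * P k j) = (if i = j then 1 else 0)"
    "\<And>i j. i < N \<Longrightarrow> j < N \<Longrightarrow> (\<Sum>k<N. P i k * Q k j) = (if i = j then 1 else 0)"
    "\<And>i j. i < N \<Longrightarrow> j < N \<Longrightarrow> d i \<noteq> d j \<Longrightarrow> (\<Sum>a<N. cnj (P a i) * P a j) = 0"
    "card {k. k < N \<and> d k > 0} = num_pos_eigenvalues A"
    "card {k. k < N \<and> d k < 0} = num_neg_eigenvalues A"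
proof -
  obtain as where "char_poly A = (\<Prod>a\<leftarrow>as. [:- a, 1:])" using char_poly_factorized[OF A] by blast
  then obtain n_as where "jordan_nf A n_as" using jordan_nf_exists[OF A] by blast
  then have sim: "similar_mat A (jordan_matrix n_as)" by (simp add: jordan_nf_def)
  define J where "J = jordan_matrix n_as"
  obtain P Q where wit: "similar_mat_wit A J P Q" using sim by (auto simp: similar_mat_def J_def)
  note w = similar_mat_witD2[OF A wit]
  have size: "sum_list (map fst n_as) = N" using w(5) by (auto simp: J_def)
  have J0: "j = Suc i \<and> J $$ (i, i) = J $$ (j, j)" if "i < N" "j < N" "i \<noteq> j" "J $$ (i, j) \<noteq> 0" for i j
    using jordan_matrix_entries[of i n_as j] that size by (simp add: J_def)
  have "A * P = P * J * (Q * P)"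
    unfolding w(3) using w by (simp add: assoc_mult_mat[of _ N N _ N _ N])
  then have AP: "A * P = P * J" using w by simp
  define G where "G = (\<lambda>i j. \<Sum>a<N. cnj (P $$ (a, i)) * P $$ (a, j))"
  \<comment> \<open>Both sides are the entry \<open>(i, j)\<close> of \<open>P^H A P\<close>, with
    \<open>A\<close> applied to the right factor or, being Hermitian, to the left one.\<close>
  have GJ: "(\<Sum>k<N. G i k * J $$ (k, j)) = (\<Sum>k<N. cnj (J $$ (k, i)) * G k j)" if ij: "i < N" "j < N" for i j
  proof -
    have AP': "(\<Sum>b<N. A $$ (a, b) * P $$ (b, j)) = (\<Sum>k<N. P $$ (a, k) * J $$ (k, j))" if "a < N" "j < N" for a j
      using arg_cong[OF AP, of "\<lambda>M. M $$ (a, j)"] that w by (simp add: index_mult_mat_sum[of _ N] del: index_mult_mat)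
    have "(\<Sum>k<N. G i k * J $$ (k, j)) = (\<Sum>a<N. cnj (P $$ (a, i)) * (\<Sum>k<N. P $$ (a, k) * J $$ (k, j)))"
      unfolding G_def sum_distrib_left sum_distrib_right by (subst sum.swap) (simp add: mult.assoc)
    also have "\<dots> = (\<Sum>a<N. cnj (P $$ (a, i)) * (\<Sum>b<N. A $$ (a, b) * P $$ (b, j)))"
      using AP' ij by (intro sum.cong) auto
    also have "\<dots> = (\<Sum>b<N. (\<Sum>a<N. cnj (A $$ (b, a) * P $$ (a, i))) * P $$ (b, j))"
      unfolding sum_distrib_left sum_distrib_right
      by (subst sum.swap) (intro sum.cong refl, auto simp: herm mult_ac)
    also have "\<dots> = (\<Sum>b<N. cnj (\<Sum>k<N. P $$ (b, k) * J $$ (k, i)) * P $$ (b, j))"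
      by (intro sum.cong refl) (simp add: AP'[symmetric] ij)
    also have "\<dots> = (\<Sum>k<N. cnj (J $$ (k, i)) * G k j)"
      unfolding G_def sum_distrib_left sum_distrib_right cnj_sum
      by (subst sum.swap) (simp add: mult_ac)
    finally show ?thesis .
  qed
  have QP: "(\<Sum>k<N. Q $$ (i, k) * P $$ (k, j)) = (if i = j then 1 else 0)" if "i < N" "j < N" for i j
    using index_mult_mat_sum[of Q N P i j] w(2,6,7) that by simp
  have PQ: "(\<Sum>k<N. P $$ (i, k) * Q $$ (k, j)) = (if i = j then 1 else 0)" if "i < N" "j < N" for i j
    using index_mult_mat_sum[of P N Q i j] w(1,6,7) that by simp
  have G_nonzero: "G k k \<noteq> 0" if k: "k < N" for k
  proof
    assume "G k k = 0"
    moreover have "G k k = complex_of_real (\<Sum>a<N. (cmod (P $$ (a, k)))\<^sup>2)"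
      unfolding G_def of_real_sum complex_norm_square by (simp add: mult.commute)
    ultimately have "(\<Sum>a<N. (cmod (P $$ (a, k)))\<^sup>2) = 0" by (metis of_real_eq_0_iff)
    then have "P $$ (a, k) = 0" if "a < N" for a using that by (simp add: sum_nonneg_eq_0_iff)
    then have "(\<Sum>a<N. Q $$ (k, a) * P $$ (a, k)) = 0" by simp
    with QP[OF k k] show False by simp
  qed
  have col: "(\<Sum>k<N. f k * J $$ (k, j)) = f j * J $$ (j, j)"
    if "j < N" "\<And>i. Suc i = j \<Longrightarrow> J $$ (i, j) = 0" for f j
  proof -
    have "J $$ (k, j) = 0" if "k < N" "k \<noteq> j" for k using J0[of k j] that \<open>j < N\<close> \<open>\<And>i. Suc i = j \<Longrightarrow> _\<close> by metis
    then have "(\<Sum>k<N. f k * J $$ (k, j)) = (\<Sum>k\<in>{j}. f k * J $$ (k, j))"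
      using \<open>j < N\<close> by (intro sum.mono_neutral_right) auto
    then show ?thesis by simp
  qed
  have col': "(\<Sum>k<N. cnj (J $$ (k, j)) * f k) = cnj (J $$ (j, j)) * f j"
    if "j < N" "\<And>i. Suc i = j \<Longrightarrow> J $$ (i, j) = 0" for f j
  proof -
    have "(\<Sum>k<N. cnj (J $$ (k, j)) * f k) = cnj (\<Sum>k<N. cnj (f k) * J $$ (k, j))"
      by (simp add: mult.commute)
    also have "\<dots> = cnj (J $$ (j, j)) * f j" using col[OF that] by (simp add: mult.commute)
    finally show ?thesis .
  qed
  have real: "cnj (J $$ (k, k)) = J $$ (k, k)" if k: "k < N" and z: "\<And>i. Suc i = k \<Longrightarrow> J $$ (i, k) = 0" for k
  proof -
    have "G k k * J $$ (k, k) = cnj (J $$ (k, k)) * G k k"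
    proof -
      have "(\<Sum>i<N. G k i * J $$ (i, k)) = G k k * J $$ (k, k)" by (rule col) (use k z in auto)
      moreover have "(\<Sum>i<N. cnj (J $$ (i, k)) * G i k) = cnj (J $$ (k, k)) * G k k"
        by (rule col') (use k z in auto)
      ultimately show ?thesis using GJ[OF k k] by metis
    qed
    then show ?thesis using G_nonzero[OF k] by (metis mult.commute mult_right_cancel)
  qed
  \<comment> \<open>Once column \<open>k\<close> is diagonal with a real entry, \<open>GJ\<close> at
    \<open>(k, Suc k)\<close> has equal terms on both sides. They cancel and leave
    \<open>G k k\<close> times the entry above the diagonal equal to zero.\<close>
  have diag: "(\<forall>i. Suc i = k \<longrightarrow> J $$ (i, k) = 0) \<and> cnj (J $$ (k, k)) = J $$ (k, k)" if "k < N" for k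
    using that
  proof (induction k)
    case 0
    then show ?case using real[of 0] by simp
  next
    case (Suc k)
    have zero: "J $$ (k, Suc k) = 0"
    proof (rule ccontr)
      assume c: "J $$ (k, Suc k) \<noteq> 0"
      have x: "J $$ (k, k) = J $$ (Suc k, Suc k)" using J0[of k "Suc k"] c Suc.prems by simp
      have "(\<Sum>i<N. G k i * J $$ (i, Suc k)) = (\<Sum>i\<in>{k, Suc k}. G k i * J $$ (i, Suc k))"
      proof (rule sum.mono_neutral_right)
        show "\<forall>i\<in>{..<N} - {k, Suc k}. G k i * J $$ (i, Suc k) = 0"
          using J0[of _ "Suc k"] Suc.prems by auto
      qed (use Suc.prems in auto)
      then have "G k k * J $$ (k, Suc k) + G k (Suc k) * J $$ (k, k) = J $$ (k, k) * G k (Suc k)"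
        using GJ[of k "Suc k"] Suc col'[of k "\<lambda>i. G i (Suc k)"] x by simp
      then show False using c G_nonzero[of k] Suc.prems by (simp add: mult.commute)
    qed
    then show ?case using real[of "Suc k"] Suc.prems by simp
  qed
  define d where "d = (\<lambda>k. Re (J $$ (k, k)))"
  have Jd: "J $$ (k, k) = complex_of_real (d k)" if "k < N" for k
    using diag[OF that] by (simp add: d_def complex_eq_iff)
  have colJ: "(\<Sum>k<N. f k * J $$ (k, j)) = f j * d j" if "j < N" for f j
    using col[OF that, of f] diag[OF that] Jd[OF that] by simp
  have "char_poly A = char_poly J"
    by (rule char_poly_similar) (use sim J_def in simp)
  also have "\<dots> = (\<Prod>a\<leftarrow>diag_mat J. [:- a, 1:])"
  proof (rule char_poly_upper_triangular)
    show "J \<in> carrier_mat N N" by (rule w(5))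
    show "upper_triangular J" using jordan_matrix_upper_triangular[of _ n_as] by (auto simp: J_def)
  qed
  also have "diag_mat J = map (\<lambda>k. complex_of_real (d k)) [0..<N]"
    using w(5) by (auto simp: diag_mat_def Jd)
  finally have cp: "char_poly A = (\<Prod>a\<leftarrow>map (\<lambda>k. complex_of_real (d k)) [0..<N]. [:- a, 1:])" .
  show ?thesis
  proof (rule that[of "\<lambda>i j. P $$ (i, j)" d "\<lambda>i j. Q $$ (i, j)"])
    show "(\<Sum>k<N. A $$ (i, k) * P $$ (k, j)) = P $$ (i, j) * d j" if "i < N" "j < N" for i j
      using arg_cong[OF AP, of "\<lambda>M. M $$ (i, j)"] that w colJ
      by (simp add: index_mult_mat_sum[of _ N] del: index_mult_mat)
    show "(\<Sum>a<N. cnj (P $$ (a, i)) * P $$ (a, j)) = 0" if ij: "i < N" "j < N" and ne: "d i \<noteq> d j" for i j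
    proof -
      have "G i j * d j = d i * G i j"
        using GJ[OF ij] colJ[OF ij(2)] col'[OF ij(1)] diag[OF ij(1)] Jd[OF ij(1)] by simp
      then have "G i j * (complex_of_real (d j) - complex_of_real (d i)) = 0" by (simp add: algebra_simps)
      then show ?thesis using ne by (simp add: G_def)
    qed
    show "card {k. k < N \<and> d k > 0} = num_pos_eigenvalues A"
      unfolding num_pos_eigenvalues_def using sum_order_eq_card[OF A cp, of "\<lambda>x. x > 0"] by simp
    show "card {k. k < N \<and> d k < 0} = num_neg_eigenvalues A"
      unfolding num_neg_eigenvalues_def using sum_order_eq_card[OF A cp, of "\<lambda>x. x < 0"] by simp
  qed (use PQ QP in auto)
qed

section \<open>Inertia of a Hermitian form and pivots of its row space\<close>

definition matrix_form :: "complex mat \<Rightarrow> nat \<Rightarrow> (nat \<Rightarrow> complex) \<Rightarrow> complex" where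
  "matrix_form A N v = (\<Sum>a<N. \<Sum>b<N. cnj (v a) * A $$ (a, b) * v b)"

lemma sum_rotate:
  "(\<Sum>a\<in>S. \<Sum>j\<in>T. \<Sum>k\<in>U. f a j k) = (\<Sum>j\<in>T. \<Sum>k\<in>U. \<Sum>a\<in>S. f a j k)"
proof -
  have "(\<Sum>a\<in>S. \<Sum>j\<in>T. \<Sum>k\<in>U. f a j k) = (\<Sum>j\<in>T. \<Sum>a\<in>S. \<Sum>k\<in>U. f a j k)"
    by (rule sum.swap)
  also have "\<dots> = (\<Sum>j\<in>T. \<Sum>k\<in>U. \<Sum>a\<in>S. f a j k)"
    by (rule sum.cong[OF refl], rule sum.swap)
  finally show ?thesis .
qed

lemma sum_kronecker:
  fixes f g :: "nat \<Rightarrow> complex"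
  assumes "i < N" "\<And>j. j < N \<Longrightarrow> g j = (if i = j then 1 else 0)"
  shows "(\<Sum>j<N. g j * f j) = f i" "(\<Sum>j<N. f j * g j) = f i"
proof -
  have terms: "g j * f j = (if i = j then f j else 0)" "f j * g j = (if i = j then f j else 0)"
    if "j < N" for j using assms(2)[OF that] by simp_all
  have "(\<Sum>j<N. g j * f j) = (\<Sum>j<N. if i = j then f j else 0)"
    "(\<Sum>j<N. f j * g j) = (\<Sum>j<N. if i = j then f j else 0)"
    by (rule sum.cong[OF refl], simp add: terms)+
  then show "(\<Sum>j<N. g j * f j) = f i" "(\<Sum>j<N. f j * g j) = f i" using assms(1) by simp_all
qed

text \<open>The form need not be diagonal in the coordinates given by \<open>P\<close>, because
  vectors of one eigenspace need not be orthogonal. But the Gram matrix commutes with functions of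
  the eigenvalues, so a square root of their negative part can be moved to both sides: where the
  positive coordinates vanish, the form is minus a squared norm. The rows of the inverse
  \<open>Q\<close> at nonzero eigenvalues provide the independent vectors in the row space of
  \<open>A\<close>.\<close>

lemma hermitian_inertia:
  fixes A :: "complex mat"
  assumes A: "A \<in> carrier_mat N N" and herm: "\<And>i j. i < N \<Longrightarrow> j < N \<Longrightarrow> cnj (A $$ (i, j)) = A $$ (j, i)"
  obtains I K :: "nat set" and L R W :: "nat \<Rightarrow> nat \<Rightarrow> complex" where
    "finite I" "card I = num_pos_eigenvalues A"
    "\<And>v. (\<And>i. i \<in> I \<Longrightarrow> (\<Sum>b<N. L i b * v b) = 0) \<Longrightarrow>
      (\<exists>x\<ge>0. matrix_form A N v = - complex_of_real x)
      \<and> (matrix_form A N v = 0 \<longrightarrow> (\<forall>a<N. (\<Sum>b<N. A $$ (a, b) * v b) = 0))"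
    "finite K" "card K = num_pos_eigenvalues A + num_neg_eigenvalues A"
    "\<And>k b. k \<in> K \<Longrightarrow> b < N \<Longrightarrow> R k b = (\<Sum>a<N. W k a * A $$ (a, b))"
    "\<And>c k. (\<And>b. b < N \<Longrightarrow> (\<Sum>k\<in>K. c k * R k b) = 0) \<Longrightarrow> k \<in> K \<Longrightarrow> c k = 0"
proof (rule hermitian_diagonalization)
  show "A \<in> carrier_mat N N" by (rule A)
  show "cnj (A $$ (i, j)) = A $$ (j, i)" if "i < N" "j < N" for i j using herm that .
next
  fix P Q :: "nat \<Rightarrow> nat \<Rightarrow> complex" and d :: "nat \<Rightarrow> real"
  assume AP: "\<And>i j. i < N \<Longrightarrow> j < N \<Longrightarrow> (\<Sum>k<N. A $$ (i, k) * P k j) = P i j * d j"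
    and QP: "\<And>i j. i < N \<Longrightarrow> j < N \<Longrightarrow> (\<Sum>k<N. Q i k * P k j) = (if i = j then 1 else 0)"
    and PQ: "\<And>i j. i < N \<Longrightarrow> j < N \<Longrightarrow> (\<Sum>k<N. P i k * Q k j) = (if i = j then 1 else 0)"
    and orth: "\<And>i j. i < N \<Longrightarrow> j < N \<Longrightarrow> d i \<noteq> d j \<Longrightarrow> (\<Sum>a<N. cnj (P a i) * P a j) = 0"
    and pos: "card {k. k < N \<and> d k > 0} = num_pos_eigenvalues A"
    and neg: "card {k. k < N \<and> d k < 0} = num_neg_eigenvalues A"
  let ?I = "{k. k < N \<and> d k > 0}" and ?K = "{k. k < N \<and> d k \<noteq> 0}"
  show thesis
  proof (rule that[of ?I Q ?K Q "\<lambda>k a. Q k a / d k"])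
    fix v assume cond: "\<And>i. i \<in> ?I \<Longrightarrow> (\<Sum>b<N. Q i b * v b) = 0"
    define c where "c = (\<lambda>k. \<Sum>b<N. Q k b * v b)"
    \<comment> \<open>At positive eigenvalues this is zero, in accordance with
      \<open>c k = 0\<close>, which \<open>cond\<close> gives there.\<close>
    define s where "s = (\<lambda>k. sqrt (max 0 (- d k)))"
    define y where "y = (\<lambda>a. \<Sum>k<N. P a k * (s k * c k))"
    have v: "v a = (\<Sum>k<N. P a k * c k)" if "a < N" for a
    proof -
      have "(\<Sum>k<N. P a k * c k) = (\<Sum>b<N. (\<Sum>k<N. P a k * Q k b) * v b)"
        unfolding c_def sum_distrib_left sum_distrib_right by (subst sum.swap) (simp add: mult.assoc)
      also have "\<dots> = v a" by (rule sum_kronecker(1)[OF that]) (rule PQ[OF that])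
      finally show ?thesis by simp
    qed
    have dc: "d k * c k = - (s k * (s k * c k))" if "k < N" for k
    proof (cases "d k > 0")
      case True
      then show ?thesis using cond[of k] that by (simp add: c_def)
    next
      case False
      then have "s k * s k = - d k" by (simp add: s_def)
      then have "complex_of_real (s k) * complex_of_real (s k) = - complex_of_real (d k)"
        by (metis of_real_minus of_real_mult)
      then show ?thesis by (metis minus_mult_left mult.assoc add.inverse_inverse)
    qed
    have Av: "(\<Sum>b<N. A $$ (a, b) * v b) = (\<Sum>k<N. P a k * (d k * c k))" if "a < N" for a
    proof -
      have "(\<Sum>b<N. A $$ (a, b) * v b) = (\<Sum>b<N. A $$ (a, b) * (\<Sum>k<N. P b k * c k))"
        using v by (intro sum.cong) auto
      also have "\<dots> = (\<Sum>k<N. (\<Sum>b<N. A $$ (a, b) * P b k) * c k)"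
        unfolding sum_distrib_left sum_distrib_right by (subst sum.swap) (simp add: mult.assoc)
      also have "\<dots> = (\<Sum>k<N. P a k * (d k * c k))"
        using AP[OF that] by (intro sum.cong) (auto simp: mult.assoc)
      finally show ?thesis .
    qed
    \<comment> \<open>For different eigenvalues the Gram entry is zero; for equal ones the two
      factors agree.\<close>
    have sG: "(\<Sum>a<N. cnj (P a j) * P a k) * s k = s j * (\<Sum>a<N. cnj (P a j) * P a k)"
      if "j < N" "k < N" for j k
      using orth[OF that] by (cases "d j = d k") (auto simp: s_def)
    have "matrix_form A N v = (\<Sum>a<N. cnj (v a) * (\<Sum>b<N. A $$ (a, b) * v b))"
      by (simp add: matrix_form_def sum_distrib_left mult.assoc)
    also have "\<dots> = (\<Sum>a<N. cnj (\<Sum>j<N. P a j * c j) * (\<Sum>k<N. P a k * (d k * c k)))"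
      using v Av by (intro sum.cong) auto
    also have "\<dots> = (\<Sum>a<N. \<Sum>j<N. \<Sum>k<N. cnj (c j) * (cnj (P a j) * P a k) * (d k * c k))"
      by (simp add: sum_product mult_ac)
    also have "\<dots> = (\<Sum>j<N. \<Sum>k<N. cnj (c j) * (\<Sum>a<N. cnj (P a j) * P a k) * (d k * c k))"
      by (subst sum_rotate) (simp add: sum_distrib_left sum_distrib_right)
    also have "\<dots> = - (\<Sum>j<N. \<Sum>k<N. cnj (s j * c j) * (\<Sum>a<N. cnj (P a j) * P a k) * (s k * c k))"
      unfolding sum_negf[symmetric]
    proof (intro sum.cong refl)
      fix j k assume "j \<in> {..<N}" "k \<in> {..<N}"
      then have jk: "j < N" "k < N" by auto
      let ?G = "\<Sum>a<N. cnj (P a j) * P a k"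
      have "cnj (c j) * ?G * (d k * c k) = - (cnj (c j) * (?G * s k) * (s k * c k))"
        unfolding dc[OF jk(2)] by (simp add: mult_ac)
      then show "cnj (c j) * ?G * (d k * c k) = - (cnj (s j * c j) * ?G * (s k * c k))"
        unfolding sG[OF jk] by (simp add: mult_ac)
    qed
    also have "(\<Sum>j<N. \<Sum>k<N. cnj (s j * c j) * (\<Sum>a<N. cnj (P a j) * P a k) * (s k * c k))
        = (\<Sum>a<N. \<Sum>j<N. \<Sum>k<N. cnj (s j * c j) * (cnj (P a j) * P a k) * (s k * c k))"
      by (subst sum_rotate) (simp add: sum_distrib_left sum_distrib_right)
    also have "\<dots> = (\<Sum>a<N. cnj (y a) * y a)"
      unfolding y_def cnj_sum sum_product by (simp add: mult_ac)
    also have "\<dots> = complex_of_real (\<Sum>a<N. (cmod (y a))\<^sup>2)"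
      unfolding of_real_sum complex_norm_square by (simp add: mult.commute)
    finally have h: "matrix_form A N v = - complex_of_real (\<Sum>a<N. (cmod (y a))\<^sup>2)" .
    have "\<forall>a<N. (\<Sum>b<N. A $$ (a, b) * v b) = 0" if "matrix_form A N v = 0"
    proof (intro allI impI)
      have "(\<Sum>a<N. (cmod (y a))\<^sup>2) = 0" using that h by (metis neg_equal_0_iff_equal of_real_eq_0_iff)
      then have y0: "y a = 0" if "a < N" for a using that by (simp add: sum_nonneg_eq_0_iff)
      have sc: "s k * c k = 0" if k: "k < N" for k
      proof -
        have "s k * c k = (\<Sum>j<N. (\<Sum>a<N. Q k a * P a j) * (s j * c j))"
          by (rule sum_kronecker(1)[OF k, symmetric]) (rule QP[OF k])
        also have "\<dots> = (\<Sum>a<N. Q k a * y a)"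
          unfolding y_def sum_distrib_left sum_distrib_right by (subst sum.swap) (simp add: mult.assoc)
        also have "\<dots> = 0" using y0 by simp
        finally show ?thesis .
      qed
      fix a assume "a < N"
      then show "(\<Sum>b<N. A $$ (a, b) * v b) = 0" unfolding Av[OF \<open>a < N\<close>]
        using dc sc by (intro sum.neutral) auto
    qed
    then show "(\<exists>x\<ge>0. matrix_form A N v = - complex_of_real x)
      \<and> (matrix_form A N v = 0 \<longrightarrow> (\<forall>a<N. (\<Sum>b<N. A $$ (a, b) * v b) = 0))"
      using h sum_nonneg[of "{..<N}" "\<lambda>a. (cmod (y a))\<^sup>2"] by auto
  next
    have "?K = ?I \<union> {k. k < N \<and> d k < 0}" by auto
    moreover have "card (?I \<union> {k. k < N \<and> d k < 0}) = card ?I + card {k. k < N \<and> d k < 0}"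
      by (rule card_Un_disjoint) auto
    ultimately show "card ?K = num_pos_eigenvalues A + num_neg_eigenvalues A"
      by (simp only: pos neg)
  next
    fix k b assume k: "k \<in> ?K" and b: "b < N"
    \<comment> \<open>Inserting the product of \<open>P\<close> and \<open>Q\<close>, which is the
      identity, after \<open>A\<close> will turn row \<open>k\<close> of \<open>Q A\<close> into
      \<open>d k\<close> times row \<open>k\<close> of \<open>Q\<close>.\<close>
    have "(\<Sum>a<N. Q k a * A $$ (a, b)) = (\<Sum>j<N. (\<Sum>a<N. Q k a * (\<Sum>e<N. A $$ (a, e) * P e j)) * Q j b)"
    proof -
      have "(\<Sum>j<N. (\<Sum>a<N. Q k a * (\<Sum>e<N. A $$ (a, e) * P e j)) * Q j b)
          = (\<Sum>a<N. Q k a * (\<Sum>e<N. A $$ (a, e) * (\<Sum>j<N. P e j * Q j b)))"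
        unfolding sum_distrib_left sum_distrib_right
        by (subst sum_rotate) (simp add: mult_ac)
      also have "\<dots> = (\<Sum>a<N. Q k a * A $$ (a, b))"
      proof (intro sum.cong refl arg_cong[of _ _ "(*) _"])
        show "(\<Sum>e<N. A $$ (a, e) * (\<Sum>j<N. P e j * Q j b)) = A $$ (a, b)" for a
          by (rule sum_kronecker(2)[OF b]) (use PQ[OF _ b] in auto)
      qed
      finally show ?thesis by simp
    qed
    also have "\<dots> = (\<Sum>j<N. (\<Sum>a<N. Q k a * (P a j * d j)) * Q j b)"
      by (intro sum.cong refl) (simp add: AP)
    also have "\<dots> = (\<Sum>j<N. (\<Sum>a<N. Q k a * P a j) * (d j * Q j b))"
      by (simp add: sum_distrib_left sum_distrib_right mult_ac)
    also have "\<dots> = d k * Q k b"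
      by (rule sum_kronecker(1)) (use k QP[of k] in auto)
    finally have "(\<Sum>a<N. Q k a * A $$ (a, b)) = d k * Q k b" .
    then have "(\<Sum>a<N. Q k a * A $$ (a, b)) / d k = Q k b" using k by simp
    then show "Q k b = (\<Sum>a<N. Q k a / d k * A $$ (a, b))" by (simp add: sum_divide_distrib)
  next
    fix c k assume c: "\<And>b. b < N \<Longrightarrow> (\<Sum>k\<in>?K. c k * Q k b) = 0" and k: "k \<in> ?K"
    have "0 = (\<Sum>b<N. (\<Sum>j\<in>?K. c j * Q j b) * P b k)" using c by simp
    also have "\<dots> = (\<Sum>j\<in>?K. c j * (\<Sum>b<N. Q j b * P b k))"
      unfolding sum_distrib_left sum_distrib_right by (subst sum.swap) (simp add: mult_ac)
    also have "\<dots> = (\<Sum>j\<in>?K. c j * (if j = k then 1 else 0))"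
      using QP k by (intro sum.cong) auto
    also have "\<dots> = c k" using k by (simp add: if_distrib cong: if_cong)
    finally show "c k = 0" by simp
  qed (use pos in auto)
qed

text \<open>The set on the right consists of the pivots of the row space. With fewer pivots than
  independent rows, a nontrivial combination would vanish at every pivot, among them its own first
  nonzero position.\<close>

lemma exists_trailing_positions:
  fixes A :: "complex mat"
  assumes "finite K"
    and R: "\<And>k b. k \<in> K \<Longrightarrow> b < N \<Longrightarrow> R k b = (\<Sum>a<N. W k a * A $$ (a, b))"
    and indep: "\<And>c k. (\<And>b. b < N \<Longrightarrow> (\<Sum>k\<in>K. c k * R k b) = 0) \<Longrightarrow> k \<in> K \<Longrightarrow> c k = 0"
  shows "card K \<le> card {b. b < N \<and> (\<exists>w. (\<Sum>a<N. w a * A $$ (a, b)) \<noteq> 0 \<and> (\<forall>b'<b. (\<Sum>a<N. w a * A $$ (a, b')) = 0))}"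
    (is "_ \<le> card ?B")
proof (rule ccontr)
  assume "\<not> ?thesis"
  then obtain c k where c: "\<forall>b\<in>?B. (\<Sum>k\<in>K. R k b * c k) = 0" and k: "k \<in> K" "c k \<noteq> 0"
    using homogeneous_system_solvable[of ?B K "\<lambda>b k. R k b"] assms(1) by auto
  define u where "u = (\<lambda>b. \<Sum>k\<in>K. c k * R k b)"
  define w where "w = (\<lambda>a. \<Sum>k\<in>K. c k * W k a)"
  have u: "u b = (\<Sum>a<N. w a * A $$ (a, b))" if "b < N" for b
  proof -
    have "u b = (\<Sum>k\<in>K. c k * (\<Sum>a<N. W k a * A $$ (a, b)))"
      unfolding u_def using R that by (intro sum.cong) auto
    also have "\<dots> = (\<Sum>a<N. w a * A $$ (a, b))"
      unfolding w_def sum_distrib_left sum_distrib_right by (subst sum.swap) (simp add: mult.assoc)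
    finally show ?thesis .
  qed
  have "\<exists>b. b < N \<and> u b \<noteq> 0" using indep[of c k] k unfolding u_def by blast
  then obtain b where b: "b < N" "u b \<noteq> 0" and least: "\<And>b'. b' < b \<Longrightarrow> u b' = 0"
    using exists_least_iff[of "\<lambda>b. b < N \<and> u b \<noteq> 0"] by (metis order.strict_trans)
  have "(\<Sum>a<N. w a * A $$ (a, b)) \<noteq> 0" using u[of b] b by simp
  moreover have "(\<Sum>a<N. w a * A $$ (a, b')) = 0" if "b' < b" for b'
    using u[of b'] least[OF that] that b by simp
  ultimately have "b \<in> ?B" using b by blast
  then have "u b = 0" using c by (simp add: u_def mult.commute)
  then show False using b by simp
qed

subsection \<open>Hermitian forms of mixed polynomials\<close>

text \<open>Artin's argument: translate the relation by a \<open>y\<close> at which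
  \<open>\<chi> s\<close> and \<open>\<chi> t\<close> differ and subtract \<open>\<chi> t y\<close>
  times the original relation; the term of \<open>t\<close> cancels.\<close>

lemma characters_independent:
  fixes \<chi> :: "'s \<Rightarrow> 'm \<Rightarrow> 'f::field"
  assumes "finite S"
    and mult: "\<And>s x y. s \<in> S \<Longrightarrow> \<chi> s (m x y) = \<chi> s x * \<chi> s y"
    and unit: "\<And>s. s \<in> S \<Longrightarrow> \<chi> s e \<noteq> 0"
    and sep: "\<And>s t. s \<in> S \<Longrightarrow> t \<in> S \<Longrightarrow> s \<noteq> t \<Longrightarrow> \<exists>x. \<chi> s x \<noteq> \<chi> t x"
    and "\<And>x. (\<Sum>s\<in>S. c s * \<chi> s x) = 0"
  shows "\<forall>s\<in>S. c s = 0"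
  using assms
proof (induction S arbitrary: c rule: finite_induct)
  case (insert t S)
  have zero: "(\<Sum>s\<in>S. c s * \<chi> s x) = - (c t * \<chi> t x)" for x
    using insert.prems(4)[of x] insert.hyps by (simp add: add_eq_0_iff)
  have cS: "c s = 0" if s: "s \<in> S" for s
  proof -
    obtain y where y: "\<chi> s y \<noteq> \<chi> t y" using insert.prems(3)[of s t] insert.hyps s by auto
    have "(\<Sum>s\<in>S. c s * (\<chi> s y - \<chi> t y) * \<chi> s x) = 0" for x
    proof -
      have "(\<Sum>s\<in>S. c s * (\<chi> s y - \<chi> t y) * \<chi> s x) = (\<Sum>s\<in>S. c s * \<chi> s (m x y)) - \<chi> t y * (\<Sum>s\<in>S. c s * \<chi> s x)"
        unfolding sum_distrib_left sum_subtractf[symmetric]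
        by (intro sum.cong refl) (simp add: insert.prems(1) algebra_simps)
      then show ?thesis unfolding zero using insert.prems(1)[of t x y] by simp
    qed
    then have "\<forall>s\<in>S. c s * (\<chi> s y - \<chi> t y) = 0"
      using insert.prems by (intro insert.IH) auto
    then show ?thesis using s y by auto
  qed
  then have "c t * \<chi> t e = 0" using zero[of e] by simp
  then show ?case using cS insert.prems(2)[of t] by auto
qed simp

text \<open>For fixed exponents this is multiplicative under the coordinatewise product of points,
  hence a character.\<close>

definition bichar :: "monomial \<times> monomial \<Rightarrow> (nat \<Rightarrow> complex) \<Rightarrow> complex" where
  "bichar s z = monom_eval (fst s) z * cnj (monom_eval (snd s) z)"

lemma monom_eval_mult: "monom_eval \<alpha> (\<lambda>i. z i * w i) = monom_eval \<alpha> z * monom_eval \<alpha> w"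
  by (simp add: monom_eval_def power_mult_distrib prod.distrib)

lemma monom_eval_one: "monom_eval \<alpha> (\<lambda>_. 1) = 1"
  by (simp add: monom_eval_def)

lemma monom_eval_single_coordinate:
  "monom_eval \<alpha> (\<lambda>j. if j = i then w else 1) = w ^ lookup \<alpha> i"
proof -
  have "monom_eval \<alpha> (\<lambda>j. if j = i then w else 1)
      = (\<Prod>j\<in>Poly_Mapping.keys \<alpha>. if j = i then w ^ lookup \<alpha> i else 1)"
    unfolding monom_eval_def by (intro prod.cong) auto
  then show ?thesis by (auto simp: in_keys_iff)
qed

text \<open>Different total degrees are separated by the modulus at \<open>w = 2\<close>. For equal
  total degrees a point of the unit circle separates \<open>a - b\<close> from
  \<open>a' - b'\<close>.\<close>

lemma power_cnj_separates:
  assumes "(a, b) \<noteq> (a', b')"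
  shows "\<exists>w::complex. w ^ a * cnj (w ^ b) \<noteq> w ^ a' * cnj (w ^ b')"
proof (cases "a + b = a' + b'")
  case False
  have "(2::complex) ^ a * cnj (2 ^ b) = of_nat (2 ^ (a + b))" for a b by (simp add: power_add)
  then have "(2::complex) ^ a * cnj (2 ^ b) \<noteq> 2 ^ a' * cnj (2 ^ b')"
    using False by (metis of_nat_eq_iff power_inject_exp one_less_numeral_iff semiring_norm(76))
  then show ?thesis by blast
next
  case True
  \<comment> \<open>As \<open>a + b = a' + b'\<close>, this is the difference between
    \<open>a - b\<close> and \<open>a' - b'\<close>; the angle \<open>pi / D\<close> turns it into a
    factor of minus one.\<close>
  define D where "D = 2 * (real a - real a')"
  have D: "D \<noteq> 0" using True assms by (auto simp: D_def)
  define t where "t = pi / D"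
  have cis: "cis t ^ a * cnj (cis t ^ b) = cis ((real a - real b) * t)" for a b
    by (simp add: DeMoivre cis_cnj cis_mult algebra_simps)
  have "real a - real b = real a' - real b' + D" using True by (simp add: D_def)
  then have "(real a - real b) * t = (real a' - real b') * t + D * t"
    by (simp add: distrib_right)
  then have "cis ((real a - real b) * t) = cis ((real a' - real b') * t + pi)"
    using D by (simp add: t_def)
  also have "\<dots> = - cis ((real a' - real b') * t)" by (simp add: cis_mult[symmetric])
  finally have "cis t ^ a * cnj (cis t ^ b) \<noteq> cis t ^ a' * cnj (cis t ^ b')"
    unfolding cis using cis_neq_zero[of "(real a' - real b') * t"] by simp
  then show ?thesis by blast
qed

lemma bichar_independent:
  assumes "finite S" "\<And>z. (\<Sum>s\<in>S. c s * bichar s z) = 0"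
  shows "\<forall>s\<in>S. c s = 0"
proof (rule characters_independent[where m = "\<lambda>z w i. z i * w i" and e = "\<lambda>_. 1" and \<chi> = bichar])
  show "\<exists>z. bichar s z \<noteq> bichar t z" if "s \<noteq> t" for s t
  proof -
    have "\<exists>i. (lookup (fst s) i, lookup (snd s) i) \<noteq> (lookup (fst t) i, lookup (snd t) i)"
    proof (rule ccontr)
      assume "\<not> ?thesis"
      then have "fst s = fst t" "snd s = snd t" by (auto intro!: poly_mapping_eqI)
      then show False using that by (simp add: prod_eq_iff)
    qed
    then obtain i where "(lookup (fst s) i, lookup (snd s) i) \<noteq> (lookup (fst t) i, lookup (snd t) i)" by blast
    from power_cnj_separates[OF this] obtain w :: complex where
      "w ^ lookup (fst s) i * cnj (w ^ lookup (snd s) i) \<noteq> w ^ lookup (fst t) i * cnj (w ^ lookup (snd t) i)" by blast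
    then have "bichar s (\<lambda>j. if j = i then w else 1) \<noteq> bichar t (\<lambda>j. if j = i then w else 1)"
      by (simp add: bichar_def monom_eval_single_coordinate)
    then show ?thesis by blast
  qed
qed (use assms in \<open>auto simp: bichar_def monom_eval_mult monom_eval_one mult_ac\<close>)

text \<open>This is \<open>mixed_eval\<close> with the values of the monomials replaced by arbitrary
  numbers: the Hermitian form of \<open>F\<close> at the linear functional with values
  \<open>\<psi>\<close> on monomials.\<close>

definition mixed_form :: "(monomial \<Rightarrow> complex) \<Rightarrow> mixed_poly \<Rightarrow> complex" where
  "mixed_form \<psi> F = (\<Sum>s\<in>Poly_Mapping.keys F. lookup F s * (\<psi> (fst s) * cnj (\<psi> (snd s))))"

lemma mixed_form_superset:
  assumes "finite S" "Poly_Mapping.keys F \<subseteq> S"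
  shows "mixed_form \<psi> F = (\<Sum>s\<in>S. lookup F s * (\<psi> (fst s) * cnj (\<psi> (snd s))))"
  unfolding mixed_form_def by (rule sum.mono_neutral_left) (use assms in \<open>auto simp: in_keys_iff\<close>)

lemma mixed_eval_mixed_form: "mixed_eval F z = mixed_form (\<lambda>\<alpha>. monom_eval \<alpha> z) F"
  unfolding mixed_eval_def mixed_form_def by (intro sum.cong) (auto simp: mult.assoc)

lemma mixed_eval_bichar:
  assumes "finite S" "Poly_Mapping.keys F \<subseteq> S"
  shows "mixed_eval F z = (\<Sum>s\<in>S. lookup F s * bichar s z)"
  unfolding mixed_eval_mixed_form mixed_form_superset[OF assms] bichar_def ..

lemma hermitian_poly_lookup:
  assumes "hermitian_poly M"
  shows "cnj (lookup M (\<alpha>, \<beta>)) = lookup M (\<beta>, \<alpha>)"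
proof -
  \<comment> \<open>The set is closed under swapping, so conjugation reindexes a sum over it. The
    two given pairs are added because their coefficients may be zero.\<close>
  define S where "S = {(\<alpha>, \<beta>), (\<beta>, \<alpha>)} \<union> Poly_Mapping.keys M \<union> prod.swap ` Poly_Mapping.keys M"
  have S: "finite S" "Poly_Mapping.keys M \<subseteq> S" and mem: "(\<beta>, \<alpha>) \<in> S" by (auto simp: S_def)
  have sw: "prod.swap ` S = S" by (auto simp: S_def image_Un image_image)
  have "(\<Sum>s\<in>S. (cnj (lookup M (prod.swap s)) - lookup M s) * bichar s z) = 0" for z
  proof -
    have "(\<Sum>s\<in>S. lookup M s * bichar s z) \<in> \<real>"
      unfolding mixed_eval_bichar[OF S, symmetric] using assms by (simp only: hermitian_poly_def)
    then have "(\<Sum>s\<in>S. lookup M s * bichar s z) = cnj (\<Sum>s\<in>S. lookup M s * bichar s z)"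
      by (rule Reals_cnj_iff[THEN iffD1, symmetric])
    also have "\<dots> = (\<Sum>s\<in>S. cnj (lookup M s) * bichar (prod.swap s) z)"
      unfolding cnj_sum by (rule sum.cong) (auto simp: bichar_def)
    also have "\<dots> = (\<Sum>s\<in>prod.swap ` S. cnj (lookup M (prod.swap s)) * bichar s z)"
      by (subst sum.reindex) (auto simp: inj_on_def)
    finally show ?thesis unfolding sw left_diff_distrib sum_subtractf by simp
  qed
  from bichar_independent[OF S(1) this] mem show ?thesis by auto
qed

text \<open>For point evaluations this is the hypothesis. Independence of the characters lifts it to
  the coefficients, and then the sum of squares can be read at every \<open>\<psi>\<close>. In the
  order on complex numbers the conclusion includes being real.\<close>

lemma sum_of_squared_norms_mixed_form_nonneg:
  assumes "sum_of_squared_norms n F"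
  shows "0 \<le> mixed_form \<psi> F"
proof -
  obtain R and h :: "nat \<Rightarrow> hpoly" where
    h: "\<And>z. mixed_eval F z = complex_of_real (\<Sum>k<R. (cmod (hpoly_eval (h k) z))\<^sup>2)"
    using assms unfolding sum_of_squared_norms_def by blast
  define T where "T = (\<Union>k<R. Poly_Mapping.keys (h k)) \<union> fst ` Poly_Mapping.keys F \<union> snd ` Poly_Mapping.keys F"
  have T: "finite T" by (simp add: T_def)
  have S: "finite (T \<times> T)" "Poly_Mapping.keys F \<subseteq> T \<times> T" using T by (force simp: T_def)+
  define lin where "lin = (\<lambda>k \<phi>. \<Sum>\<alpha>\<in>T. lookup (h k) \<alpha> * \<phi> \<alpha>)"
  have hl: "hpoly_eval (h k) z = lin k (\<lambda>\<alpha>. monom_eval \<alpha> z)" if "k < R" for k z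
    unfolding hpoly_eval_def lin_def
    by (rule sum.mono_neutral_left) (use T that in \<open>auto simp: T_def in_keys_iff\<close>)
  have sq: "complex_of_real ((cmod (lin k \<phi>))\<^sup>2)
      = (\<Sum>s\<in>T \<times> T. lookup (h k) (fst s) * cnj (lookup (h k) (snd s)) * (\<phi> (fst s) * cnj (\<phi> (snd s))))" for k \<phi>
    unfolding complex_norm_square lin_def cnj_sum sum_product sum.cartesian_product
    by (intro sum.cong) (auto simp: mult_ac)
  define c where "c = (\<lambda>s. \<Sum>k<R. lookup (h k) (fst s) * cnj (lookup (h k) (snd s)))"
  have sqs: "complex_of_real (\<Sum>k<R. (cmod (lin k \<phi>))\<^sup>2) = (\<Sum>s\<in>T \<times> T. c s * (\<phi> (fst s) * cnj (\<phi> (snd s))))" for \<phi>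
    unfolding of_real_sum sq c_def sum_distrib_right by (rule sum.swap)
  have "(\<Sum>s\<in>T \<times> T. (lookup F s - c s) * bichar s z) = 0" for z
  proof -
    have "(\<Sum>s\<in>T \<times> T. lookup F s * bichar s z) = complex_of_real (\<Sum>k<R. (cmod (lin k (\<lambda>\<alpha>. monom_eval \<alpha> z)))\<^sup>2)"
      unfolding mixed_eval_bichar[OF S, symmetric] h using hl by simp
    also have "\<dots> = (\<Sum>s\<in>T \<times> T. c s * bichar s z)" unfolding sqs bichar_def ..
    finally show ?thesis by (simp add: left_diff_distrib sum_subtractf)
  qed
  from bichar_independent[OF S(1) this] have "lookup F s = c s" if "s \<in> T \<times> T" for s using that by auto
  then have "mixed_form \<psi> F = complex_of_real (\<Sum>k<R. (cmod (lin k \<psi>))\<^sup>2)"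
    unfolding mixed_form_superset[OF S] sqs by (intro sum.cong) auto
  then show ?thesis by (simp add: sum_nonneg less_eq_complex_def del: of_real_sum)
qed

section \<open>Multiplication by the squared norm as translation of functionals\<close>

lemma mixed_form_zero [simp]: "mixed_form \<psi> 0 = 0"
  by (simp add: mixed_form_def)

lemma mixed_form_add: "mixed_form \<psi> (F + G) = mixed_form \<psi> F + mixed_form \<psi> G"
proof -
  let ?S = "Poly_Mapping.keys F \<union> Poly_Mapping.keys G"
  show ?thesis
    using mixed_form_superset[of ?S F] mixed_form_superset[of ?S G] mixed_form_superset[of ?S "F + G"] keys_add[of F G]
    by (simp add: lookup_add distrib_right sum.distrib)
qed

lemma mixed_form_sum: "mixed_form \<psi> (sum f A) = (\<Sum>a\<in>A. mixed_form \<psi> (f a))"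
  by (induction A rule: infinite_finite_induct) (simp_all add: mixed_form_add)

lemma mixed_form_single: "mixed_form \<psi> (Poly_Mapping.single s c) = c * (\<psi> (fst s) * cnj (\<psi> (snd s)))"
  by (cases "c = 0") (simp_all add: mixed_form_def)

lemma poly_mapping_sum_singles: "(\<Sum>s\<in>Poly_Mapping.keys F. Poly_Mapping.single s (lookup F s)) = F"
  by (rule poly_mapping_eqI) (simp add: lookup_sum lookup_single when_def in_keys_iff)

lemma mixed_form_mult_single:
  "mixed_form \<psi> (F * Poly_Mapping.single (\<gamma>, \<gamma>) 1) = mixed_form (\<lambda>\<alpha>. \<psi> (\<alpha> + \<gamma>)) F"
proof -
  have "F * Poly_Mapping.single (\<gamma>, \<gamma>) 1
      = (\<Sum>s\<in>Poly_Mapping.keys F. Poly_Mapping.single s (lookup F s) * Poly_Mapping.single (\<gamma>, \<gamma>) 1)"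
    by (subst poly_mapping_sum_singles[of F, symmetric]) (rule sum_distrib_right)
  then show ?thesis by (simp add: mixed_form_sum mult_single mixed_form_single) (simp add: mixed_form_def)
qed

lemma mixed_form_mult_norm_sq:
  "mixed_form \<psi> (F * norm_sq_poly n) = (\<Sum>i<n. mixed_form (\<lambda>\<alpha>. \<psi> (\<alpha> + var i)) F)"
  by (simp add: norm_sq_poly_def sum_distrib_left mixed_form_sum mixed_form_mult_single)

text \<open>The form of the product is a positively weighted sum of forms of \<open>M\<close> at
  translates of \<open>\<psi>\<close>, and a vanishing sum of nonpositive numbers has vanishing
  terms. Peeling off one factor at a time keeps the multinomial weights out of sight.\<close>

lemma mixed_form_mult_norm_sq_power:
  assumes "\<And>\<alpha>. \<alpha> \<in> mons n l \<Longrightarrow> mixed_form (\<lambda>\<beta>. \<psi> (\<beta> + \<alpha>)) M \<le> 0"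
  shows "mixed_form \<psi> (M * norm_sq_poly n ^ l) \<le> 0
    \<and> (mixed_form \<psi> (M * norm_sq_poly n ^ l) = 0 \<longrightarrow> (\<forall>\<alpha>\<in>mons n l. mixed_form (\<lambda>\<beta>. \<psi> (\<beta> + \<alpha>)) M = 0))"
  using assms
proof (induction l arbitrary: \<psi>)
  case 0
  then show ?case by simp
next
  case (Suc l)
  let ?g = "\<lambda>i. mixed_form (\<lambda>\<alpha>. \<psi> (\<alpha> + var i)) (M * norm_sq_poly n ^ l)"
  have eq: "mixed_form \<psi> (M * norm_sq_poly n ^ Suc l) = (\<Sum>i<n. ?g i)"
    unfolding power_Suc2 mult.assoc[symmetric] by (rule mixed_form_mult_norm_sq)
  have IH: "?g i \<le> 0 \<and> (?g i = 0 \<longrightarrow> (\<forall>\<alpha>\<in>mons n l. mixed_form (\<lambda>\<beta>. \<psi> (\<beta> + \<alpha> + var i)) M = 0))" if "i < n" for i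
  proof (rule Suc.IH)
    fix \<alpha> assume "\<alpha> \<in> mons n l"
    then have "\<alpha> + var i \<in> mons n (Suc l)" using mons_add[OF _ var_mons[OF that], of \<alpha> l] by simp
    from Suc.prems[OF this] show "mixed_form (\<lambda>\<beta>. \<psi> (\<beta> + \<alpha> + var i)) M \<le> 0" by (simp add: add.assoc)
  qed
  have "mixed_form (\<lambda>\<beta>. \<psi> (\<beta> + \<alpha>)) M = 0" if "(\<Sum>i<n. ?g i) = 0" "\<alpha> \<in> mons n (Suc l)" for \<alpha>
  proof -
    have "\<alpha> \<in> shadow n (mons n l)" using that(2) by (simp add: shadow_mons_all)
    then obtain i \<alpha>' where a: "i < n" "\<alpha>' \<in> mons n l" "\<alpha> = \<alpha>' + var i" by (auto simp: shadow_def)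
    have "\<forall>i\<in>{..<n}. - ?g i = 0"
      using that(1) IH by (subst sum_nonneg_eq_0_iff[symmetric]) (auto simp: sum_negf)
    then have "?g i = 0" using a(1) by simp
    then have "\<forall>\<alpha>\<in>mons n l. mixed_form (\<lambda>\<beta>. \<psi> (\<beta> + \<alpha> + var i)) M = 0" using IH[OF a(1)] by blast
    then show ?thesis using a by (simp add: add.assoc)
  qed
  moreover have "(\<Sum>i<n. ?g i) \<le> 0" by (rule sum_nonpos) (use IH in auto)
  ultimately show ?case unfolding eq by blast
qed

subsection \<open>Macaulay representations\<close>

text \<open>As the entries increase strictly, the sum up to \<open>m\<close> stays below
  \<open>a (Suc m) choose m\<close>, and Pascal's rule absorbs the next term. This makes the top
  entry the greedy one.\<close>

lemma macaulay_rep_less: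
  assumes "macaulay_rep A N \<delta> a"
  shows "A < Suc (a N) choose N"
proof -
  have "(\<Sum>j=\<delta>..N. a j choose j) < Suc (a N) choose N"
    if "\<delta> \<le> N" "1 \<le> \<delta>" "strict_mono_on {\<delta>..N} a" "\<forall>j\<in>{\<delta>..N}. j \<le> a j" for N
    using that
  proof (induction N rule: dec_induct)
    case base
    then obtain e where "\<delta> = Suc e" by (cases \<delta>) auto
    then show ?case using base by simp
  next
    case (step m)
    have "a m < a (Suc m)" using step.prems(2) step.hyps by (simp add: strict_mono_on_def)
    then have "Suc (a m) choose m \<le> a (Suc m) choose m" by (intro binomial_right_mono) simp
    moreover have "(\<Sum>j=\<delta>..m. a j choose j) < Suc (a m) choose m"
      using step by (intro step.IH) (auto simp: strict_mono_on_def)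
    ultimately show ?case using step.hyps by simp
  qed
  then show ?thesis using assms by (auto simp: macaulay_rep_def)
qed

lemma macaulay_rep_ge:
  assumes "macaulay_rep A N \<delta> a" shows "a N choose N \<le> A"
  using assms by (auto simp: macaulay_rep_def intro!: member_le_sum)

lemma macaulay_rep_pos:
  assumes "macaulay_rep A N \<delta> a" shows "0 < A"
proof -
  have "0 < a N choose N" using assms by (auto simp: macaulay_rep_def)
  then show ?thesis using macaulay_rep_ge[OF assms] by linarith
qed

lemma macaulay_rep_Suc:
  assumes "macaulay_rep A (Suc N) \<delta> a" "\<delta> \<noteq> Suc N"
  shows "macaulay_rep (A - (a (Suc N) choose Suc N)) N \<delta> a"
  using assms by (auto simp: macaulay_rep_def strict_mono_on_def)

text \<open>The top entry is the largest one whose binomial does not exceed \<open>A\<close>. The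
  remainder is positive exactly when further terms follow, so both representations stop at the same
  index.\<close>

lemma macaulay_rep_unique:
  assumes "macaulay_rep A N \<delta> a" "macaulay_rep A N \<epsilon> b"
  shows "\<delta> = \<epsilon> \<and> (\<forall>j\<in>{\<delta>..N}. a j = b j)"
  using assms
proof (induction N arbitrary: A \<delta> \<epsilon>)
  case 0
  then show ?case by (auto simp: macaulay_rep_def)
next
  case (Suc N)
  have le: "a (Suc N) \<le> b (Suc N)"
    if "macaulay_rep A (Suc N) \<delta> a" "macaulay_rep A (Suc N) \<epsilon> b" for a b \<delta> \<epsilon>
  proof (rule ccontr)
    assume "\<not> ?thesis"
    then have "Suc (b (Suc N)) choose Suc N \<le> a (Suc N) choose Suc N"
      by (intro binomial_right_mono) simp
    with macaulay_rep_less[OF that(2)] macaulay_rep_ge[OF that(1)] show False by linarith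
  qed
  have top: "a (Suc N) = b (Suc N)" using le[OF Suc.prems] le[OF Suc.prems(2,1)] by simp
  have last: "A = a (Suc N) choose Suc N" if "macaulay_rep A (Suc N) (Suc N) a" for a
    using that by (simp add: macaulay_rep_def)
  have bound: "\<delta> \<le> Suc N" "\<epsilon> \<le> Suc N" using Suc.prems by (auto simp: macaulay_rep_def)
  consider "\<delta> = Suc N" "\<epsilon> = Suc N" | "\<delta> = Suc N" "\<epsilon> \<noteq> Suc N" | "\<delta> \<noteq> Suc N" "\<epsilon> = Suc N" | "\<delta> \<noteq> Suc N" "\<epsilon> \<noteq> Suc N"
    by blast
  then show ?case
  proof cases
    case 1
    then show ?thesis using top by simp
  next
    case 2
    then show ?thesis
      using macaulay_rep_pos[OF macaulay_rep_Suc[OF Suc.prems(2)]] last[of a] Suc.prems(1) top by simp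
  next
    case 3
    then show ?thesis
      using macaulay_rep_pos[OF macaulay_rep_Suc[OF Suc.prems(1)]] last[of b] Suc.prems(2) top by simp
  next
    case 4
    then have "\<delta> = \<epsilon> \<and> (\<forall>j\<in>{\<delta>..N}. a j = b j)"
      using Suc.IH macaulay_rep_Suc Suc.prems top by metis
    then show ?thesis using top by (auto simp: le_Suc_eq)
  qed
qed

lemma macaulay_rep_exists:
  assumes "0 < A" "0 < N" shows "\<exists>\<delta> a. macaulay_rep A N \<delta> a"
proof -
  have "\<exists>\<delta> a. macaulay_rep A (Suc N) \<delta> a" if "0 < A" for N
    using that
  proof (induction N arbitrary: A)
    case 0
    then show ?case by (intro exI[of _ 1] exI[of _ "\<lambda>_. A"]) (auto simp: macaulay_rep_def strict_mono_on_def)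
  next
    case (Suc N)
    let ?n = "Suc (Suc N)"
    define m where "m = (GREATEST m. m choose ?n \<le> A)"
    \<comment> \<open>The greatest \<open>m\<close> exists because the candidates are
      bounded.\<close>
    have bnd: "\<forall>m. m choose ?n \<le> A \<longrightarrow> m \<le> A + ?n"
    proof (intro allI impI)
      fix m assume m: "m choose ?n \<le> A"
      have "t < (t + ?n) choose ?n" for t
      proof (induction t)
        case (Suc t)
        have "0 < (t + ?n) choose Suc N" by simp
        moreover have "(Suc t + ?n) choose ?n = ((t + ?n) choose Suc N) + ((t + ?n) choose ?n)"
          by simp
        ultimately show ?case using Suc by linarith
      qed simp
      from this[of A] m have "\<not> (A + ?n) choose ?n \<le> m choose ?n" by linarith
      then show "m \<le> A + ?n" using binomial_right_mono[of "A + ?n" m ?n] by linarith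
    qed
    have n: "?n choose ?n \<le> A" using Suc.prems by simp
    have m: "m choose ?n \<le> A" unfolding m_def
      by (rule GreatestI_nat[where P = "\<lambda>m. m choose ?n \<le> A" and k = ?n]) (use bnd n in blast)+
    have mn: "?n \<le> m" unfolding m_def
      by (rule Greatest_le_nat[where P = "\<lambda>m. m choose ?n \<le> A" and k = ?n]) (use bnd n in blast)+
    have "\<not> Suc m choose ?n \<le> A"
    proof
      assume "Suc m choose ?n \<le> A"
      then have "Suc m \<le> m" unfolding m_def
        by (rule Greatest_le_nat[where P = "\<lambda>m. m choose ?n \<le> A"]) (use bnd n in blast)+
      then show False by simp
    qed
    \<comment> \<open>Maximality of \<open>m\<close> and Pascal's rule bound the remainder; this
      forces the next entry below \<open>m\<close>.\<close>
    then have lt: "A - (m choose ?n) < m choose Suc N" using m by simp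
    show ?case
    proof (cases "A = m choose ?n")
      case True
      then show ?thesis using mn
        by (intro exI[of _ ?n] exI[of _ "\<lambda>_. m"]) (auto simp: macaulay_rep_def strict_mono_on_def)
    next
      case False
      then obtain \<delta> a where rep: "macaulay_rep (A - (m choose ?n)) (Suc N) \<delta> a"
        using Suc.IH[of "A - (m choose ?n)"] m by auto
      have "a (Suc N) choose Suc N < m choose Suc N" using macaulay_rep_ge[OF rep] lt by linarith
      then have "a (Suc N) < m" using binomial_right_mono[of m "a (Suc N)" "Suc N"] by linarith
      moreover have "a j \<le> a (Suc N)" if "j \<in> {\<delta>..Suc N}" for j
      proof (cases "j = Suc N")
        case False
        then show ?thesis
          using rep that by (simp add: macaulay_rep_def strict_mono_on_def less_imp_le)
      qed simp
      ultimately have below: "a j < m" if "j \<in> {\<delta>..Suc N}" for j using that by fastforce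
      have "macaulay_rep A ?n \<delta> (a(?n := m))"
        unfolding macaulay_rep_def
      proof (intro conjI)
        show "strict_mono_on {\<delta>..?n} (a(?n := m))"
        proof (rule strict_mono_onI)
          fix i j assume ij: "i \<in> {\<delta>..?n}" "j \<in> {\<delta>..?n}" "i < j"
          show "(a(?n := m)) i < (a(?n := m)) j"
          proof (cases "j = ?n")
            case True
            then show ?thesis using below[of i] ij by simp
          next
            case False
            then have "i \<in> {\<delta>..Suc N}" "j \<in> {\<delta>..Suc N}" using ij by auto
            moreover have "strict_mono_on {\<delta>..Suc N} a" using rep by (simp add: macaulay_rep_def)
            ultimately have "a i < a j" using ij by (simp add: strict_mono_on_def)
            then show ?thesis using ij False by simp
          qed
        qed
        have "(\<Sum>j = \<delta>..?n. (a(?n := m)) j choose j) = (\<Sum>j = \<delta>..Suc N. a j choose j) + (m choose ?n)"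
          using rep by (simp add: macaulay_rep_def)
        then show "A = (\<Sum>j = \<delta>..?n. (a(?n := m)) j choose j)"
          using rep m unfolding macaulay_rep_def by linarith
      qed (use rep mn in \<open>auto simp: macaulay_rep_def le_Suc_eq\<close>)
      then show ?thesis by blast
    qed
  qed
  from this[OF assms(1), of "N - 1"] assms(2) show ?thesis by simp
qed

lemma macaulay_shift_eq:
  assumes "macaulay_rep A N \<delta> a"
  shows "macaulay_shift A N \<sigma> \<tau> = (\<Sum>j=\<delta>..N. int_choose (int (a j) + \<tau>) (int j + \<sigma>))"
proof -
  have "(THE v. \<exists>\<delta> a. macaulay_rep A N \<delta> a \<and> v = (\<Sum>j=\<delta>..N. int_choose (int (a j) + \<tau>) (int j + \<sigma>)))
      = (\<Sum>j=\<delta>..N. int_choose (int (a j) + \<tau>) (int j + \<sigma>))"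
  proof (rule the_equality)
    fix v assume "\<exists>\<delta> a. macaulay_rep A N \<delta> a \<and> v = (\<Sum>j=\<delta>..N. int_choose (int (a j) + \<tau>) (int j + \<sigma>))"
    then obtain \<epsilon> b where b: "macaulay_rep A N \<epsilon> b"
      and v: "v = (\<Sum>j=\<epsilon>..N. int_choose (int (b j) + \<tau>) (int j + \<sigma>))" by blast
    from macaulay_rep_unique[OF assms b]
    show "v = (\<Sum>j=\<delta>..N. int_choose (int (a j) + \<tau>) (int j + \<sigma>))"
      unfolding v by (auto intro!: sum.cong)
  qed (use assms in blast)
  then show ?thesis using macaulay_rep_pos[OF assms] by (simp add: macaulay_shift_def)
qed

text \<open>Expanding the last term of the Macaulay representation of \<open>p\<close> by the hockey-stick identity
  turns it into the representation of \<open>p - 1\<close> in the combinatorial number system, in which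
  no index \<open>\<delta>\<close> is needed.\<close>

lemma macaulay_shift_combinadic:
  assumes "0 < p" "0 < N"
  shows "\<exists>c. strict_mono c \<and> (\<Sum>j<N. c j choose Suc j) < p \<and>
    macaulay_shift p N (-1) (int k) = int (\<Sum>j<N. (c j + k) choose j)"
proof -
  obtain \<delta> a where rep: "macaulay_rep p N \<delta> a" using macaulay_rep_exists[OF assms] by blast
  then have \<delta>: "1 \<le> \<delta>" "\<delta> \<le> N" and mono: "strict_mono_on {\<delta>..N} a" and \<delta>a: "\<delta> \<le> a \<delta>"
    and p: "p = (\<Sum>j=\<delta>..N. a j choose j)" by (auto simp: macaulay_rep_def)
  define r where "r = a \<delta> - \<delta>"
  \<comment> \<open>Positions below \<open>\<delta>\<close> hold the hockey-stick expansion of the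
    last term. From \<open>\<delta>\<close> on the entries move down by one position, since
    \<open>c j\<close> has lower index \<open>Suc j\<close>. From \<open>N\<close> on the sequence
    is continued so as to increase strictly.\<close>
  define c where "c = (\<lambda>j. if j < \<delta> then r + j else if j < N then a (Suc j) else a N + Suc j)"
  have aS: "a j < a (Suc j)" if "\<delta> \<le> j" "j < N" for j
    using mono that by (auto simp: strict_mono_on_def)
  have c: "strict_mono c"
    unfolding strict_mono_Suc_iff
  proof
    fix j
    consider "Suc j < \<delta>" | "Suc j = \<delta>" | "\<delta> \<le> j" "Suc j < N" | "\<delta> \<le> j" "Suc j = N" | "N \<le> j"
      by linarith
    then show "c j < c (Suc j)"
    proof cases
      case 2
      then show ?thesis using aS[of \<delta>] \<delta>a \<delta> by (auto simp: c_def r_def)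
    next
      case 3
      then show ?thesis using aS[of "Suc j"] by (auto simp: c_def)
    qed (use \<delta> in \<open>auto simp: c_def\<close>)
  qed
  have split: "(\<Sum>j<N. f (c j) j) = (\<Sum>j<\<delta>. f (r + j) j) + (\<Sum>j=\<delta>..<N. f (a (Suc j)) j)"
    for f :: "nat \<Rightarrow> nat \<Rightarrow> nat"
  proof -
    have "(\<Sum>j<N. f (c j) j) = (\<Sum>j<\<delta>. f (c j) j) + (\<Sum>j=\<delta>..<N. f (c j) j)"
      using sum.atLeastLessThan_concat[of 0 \<delta> N "\<lambda>j. f (c j) j"] \<delta> by (simp add: atLeast0LessThan)
    then show ?thesis by (simp add: c_def)
  qed
  have shift: "(\<Sum>j=\<delta>..N. g j) = g \<delta> + (\<Sum>j=\<delta>..<N. g (Suc j))" for g :: "nat \<Rightarrow> nat"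
    using \<delta>(2) sum.atLeast_Suc_atMost[of \<delta> N g] sum.shift_bounds_Suc_ivl[of g \<delta> N]
    by (simp add: atLeastLessThanSuc_atLeastAtMost)
  \<comment> \<open>The successor is the index-zero term of the hockey-stick sum; it is the reason
    why \<open>c\<close> represents \<open>p - 1\<close>.\<close>
  have hockey1: "Suc (\<Sum>j<t. (r + j) choose Suc j) = (r + t) choose t" for t
    by (induction t) auto
  have "Suc (\<Sum>j<N. c j choose Suc j) = p"
    unfolding split[of "\<lambda>x j. x choose Suc j"] p shift[of "\<lambda>j. a j choose j"]
    using hockey1[of \<delta>] \<delta>a by (simp add: r_def)
  moreover have "macaulay_shift p N (-1) (int k) = int (\<Sum>j<N. (c j + k) choose j)"
  proof -
    have "macaulay_shift p N (-1) (int k) = (\<Sum>j=\<delta>..N. int ((a j + k) choose (j - 1)))"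
      unfolding macaulay_shift_eq[OF rep]
      using \<delta> by (intro sum.cong refl) (auto simp: int_choose_def nat_diff_distrib nat_add_distrib)
    also have "\<dots> = int (((a \<delta> + k) choose (\<delta> - 1)) + (\<Sum>j=\<delta>..<N. (a (Suc j) + k) choose j))"
      using shift[of "\<lambda>j. (a j + k) choose (j - 1)"] by (simp flip: of_nat_sum)
    \<comment> \<open>With lower index \<open>\<delta> - 1\<close> the expansion is complete, so
      here the sums agree exactly.\<close>
    also have "(a \<delta> + k) choose (\<delta> - 1) = (\<Sum>j<\<delta>. (r + j + k) choose j)"
    proof -
      obtain t where t: "\<delta> = Suc t" using \<delta>(1) by (cases \<delta>) auto
      have "(\<Sum>j\<le>t. (r + k + j) choose j) = Suc (r + k + t) choose t" by (rule sum_choose_lower)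
      then show ?thesis using \<delta>a by (simp add: t r_def lessThan_Suc_atMost add_ac)
    qed
    finally show ?thesis unfolding split[of "\<lambda>x j. (x + k) choose j"] .
  qed
  ultimately show ?thesis using c by (intro exI[of _ c]) auto
qed

subsection \<open>The signature bound\<close>

lemma shadow_pow_decompose:
  assumes "\<gamma> \<in> (shadow n ^^ l) E"
  shows "\<exists>\<beta>\<in>E. \<exists>\<alpha>\<in>mons n l. \<gamma> = \<beta> + \<alpha>"
  using assms
proof (induction l arbitrary: \<gamma>)
  case (Suc l)
  have "\<gamma> \<in> shadow n ((shadow n ^^ l) E)" using Suc.prems by simp
  then obtain i \<gamma>' where i: "i < n" "\<gamma> = \<gamma>' + var i" "\<gamma>' \<in> (shadow n ^^ l) E"
    unfolding shadow_def[of n "(shadow n ^^ l) E"] by blast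
  with Suc.IH obtain \<beta> \<alpha> where "\<beta> \<in> E" "\<alpha> \<in> mons n l" "\<gamma>' = \<beta> + \<alpha>" by blast
  moreover from this have "\<alpha> + var i \<in> mons n (Suc l)" using mons_add[OF _ var_mons[OF i(1)]] by fastforce
  ultimately show ?case using i(2) by (metis add.assoc)
qed auto

lemma finite_shadow_pow: "finite E \<Longrightarrow> finite ((shadow n ^^ l) E)"
  by (induction l) (simp_all add: finite_shadow)

lemma set_monomials: "set (monomials n d) = mons n d" "distinct (monomials n d)" "sorted (monomials n d)"
  using finite_mons[of n d] by (simp_all add: monomials_def mons_def)

lemma mixed_form_eq_matrix_form:
  assumes "mixed_poly_on n M" "bihomogeneous d M"
  shows "mixed_form \<psi> M = matrix_form (coeff_matrix n d M) (length (monomials n d)) (\<lambda>b. \<psi> (monomials n d ! b))"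
proof -
  let ?ms = "monomials n d" and ?N = "length (monomials n d)"
  have "Poly_Mapping.keys M \<subseteq> mons n d \<times> mons n d"
    using assms by (fastforce simp: mixed_poly_on_def bihomogeneous_def mons_def)
  then have "mixed_form \<psi> M = (\<Sum>s\<in>mons n d \<times> mons n d. lookup M s * (\<psi> (fst s) * cnj (\<psi> (snd s))))"
    by (intro mixed_form_superset) (simp_all add: finite_mons)
  also have "\<dots> = (\<Sum>\<alpha>\<in>mons n d. \<Sum>\<beta>\<in>mons n d. lookup M (\<alpha>, \<beta>) * (\<psi> \<alpha> * cnj (\<psi> \<beta>)))"
    by (simp add: sum.cartesian_product case_prod_beta)
  also have "\<dots> = (\<Sum>\<beta>\<in>mons n d. \<Sum>\<alpha>\<in>mons n d. cnj (\<psi> \<beta>) * lookup M (\<alpha>, \<beta>) * \<psi> \<alpha>)"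
    by (subst sum.swap) (simp add: mult_ac)
  also have "\<dots> = (\<Sum>a<?N. \<Sum>b<?N. cnj (\<psi> (?ms ! a)) * lookup M (?ms ! b, ?ms ! a) * \<psi> (?ms ! b))"
  proof -
    have "bij_betw ((!) ?ms) {..<?N} (mons n d)"
      using bij_betw_nth[OF set_monomials(2)] set_monomials(1) by metis
    then show ?thesis by (simp add: sum.reindex_bij_betw[symmetric])
  qed
  also have "\<dots> = matrix_form (coeff_matrix n d M) ?N (\<lambda>b. \<psi> (?ms ! b))"
    unfolding matrix_form_def by (intro sum.cong refl) (simp add: coeff_matrix_def Let_def)
  finally show ?thesis .
qed

text \<open>The row space of the coefficient matrix is the span of all \<open>f\<close> and
  \<open>g\<close>, of dimension \<open>p + q\<close>, and \<open>E\<close> consists of its trailing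
  monomials. The bound on the right counts the linear conditions on a functional: one for each
  positive eigenvalue, with multiplicity, and each monomial of degree \<open>l\<close>.\<close>

lemma rank_growth_bound:
  assumes M: "mixed_poly_on n M" "hermitian_poly M" "bihomogeneous d M"
    and sos: "sum_of_squared_norms n (M * norm_sq_poly n ^ l)"
    and sig: "signature n d M = (p, q)"
  shows "\<exists>E\<subseteq>mons n d. p + q \<le> card E \<and> card ((shadow n ^^ l) E) \<le> p * card (mons n l)"
proof -
  let ?ms = "monomials n d"
  define N where "N = length ?ms"
  define A where "A = coeff_matrix n d M"
  have A: "A \<in> carrier_mat N N" by (simp add: A_def N_def coeff_matrix_def Let_def)
  have herm: "cnj (A $$ (i, j)) = A $$ (j, i)" if "i < N" "j < N" for i j
    using that hermitian_poly_lookup[OF M(2)] by (simp add: A_def N_def coeff_matrix_def Let_def)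
  have pq: "p = num_pos_eigenvalues A" "q = num_neg_eigenvalues A"
    using sig by (simp_all add: signature_def A_def)
  \<comment> \<open>Since the list increases, the first nonzero position of a row combination is its
    smallest monomial.\<close>
  have less_ms: "?ms ! b < ?ms ! b'" if "b < b'" "b' < N" for b b'
    using that set_monomials[of n d] sorted_wrt_nth_less[of "(<)" ?ms b b']
    by (simp add: N_def strict_sorted_iff)
  show ?thesis
  proof (rule hermitian_inertia)
    show "A \<in> carrier_mat N N" by (rule A)
    show "cnj (A $$ (i, j)) = A $$ (j, i)" if "i < N" "j < N" for i j using herm that .
  next
    fix I K :: "nat set" and L R W :: "nat \<Rightarrow> nat \<Rightarrow> complex"
    assume I: "finite I" "card I = num_pos_eigenvalues A"
      and nonpos: "\<And>v. (\<And>i. i \<in> I \<Longrightarrow> (\<Sum>b<N. L i b * v b) = 0) \<Longrightarrow>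
        (\<exists>x\<ge>0. matrix_form A N v = - complex_of_real x)
        \<and> (matrix_form A N v = 0 \<longrightarrow> (\<forall>a<N. (\<Sum>b<N. A $$ (a, b) * v b) = 0))"
      and K: "finite K" "card K = num_pos_eigenvalues A + num_neg_eigenvalues A"
      and R: "\<And>k b. k \<in> K \<Longrightarrow> b < N \<Longrightarrow> R k b = (\<Sum>a<N. W k a * A $$ (a, b))"
      and indep: "\<And>c k. (\<And>b. b < N \<Longrightarrow> (\<Sum>k\<in>K. c k * R k b) = 0) \<Longrightarrow> k \<in> K \<Longrightarrow> c k = 0"
    define B where "B = {b. b < N \<and> (\<exists>w. (\<Sum>a<N. w a * A $$ (a, b)) \<noteq> 0 \<and> (\<forall>b'<b. (\<Sum>a<N. w a * A $$ (a, b')) = 0))}"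
    define E where "E = (!) ?ms ` B"
    have "card K \<le> card B"
      unfolding B_def by (rule exists_trailing_positions[of K N R W A]) (fact K(1) R indep)+
    moreover have "card E = card B"
      unfolding E_def by (rule card_image)
        (auto simp: inj_on_def B_def N_def nth_eq_iff_index_eq[OF set_monomials(2)])
    ultimately have cardE: "p + q \<le> card E" using K(2) pq by simp
    have E: "E \<subseteq> mons n d"
      using nth_mem[of _ ?ms] by (auto simp: E_def B_def N_def set_monomials)
    define F where "F = (shadow n ^^ l) E"
    have F: "finite F" unfolding F_def
      by (rule finite_shadow_pow) (rule finite_subset[OF E finite_mons])
    have "card F \<le> p * card (mons n l)"
    proof (rule ccontr)
      assume "\<not> card F \<le> p * card (mons n l)"
      then have "card (I \<times> mons n l) < card F" using I(2) pq by (simp add: card_cartesian_product)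
      then obtain \<phi> \<gamma>0 where \<phi>: "\<And>i \<alpha>. i \<in> I \<Longrightarrow> \<alpha> \<in> mons n l \<Longrightarrow>
          (\<Sum>\<gamma>\<in>F. (\<Sum>b<N. L i b * (if ?ms ! b + \<alpha> = \<gamma> then 1 else 0)) * \<phi> \<gamma>) = 0"
        and \<gamma>0: "\<gamma>0 \<in> F" "\<phi> \<gamma>0 \<noteq> 0"
        using homogeneous_system_solvable[of "I \<times> mons n l" F
            "\<lambda>s \<gamma>. \<Sum>b<N. L (fst s) b * (if ?ms ! b + snd s = \<gamma> then 1 else 0)"] I(1) F
        by (auto simp: finite_mons)
      \<comment> \<open>As a linear functional on polynomials of degree \<open>d + l\<close>, \<open>\<psi>\<close> annihilates every monomial
        multiple of the positive squares; positivity then forces it to annihilate those of the negative ones.\<close>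
      define \<psi> where "\<psi> = (\<lambda>\<gamma>. if \<gamma> \<in> F then \<phi> \<gamma> else 0)"
      let ?v = "\<lambda>\<alpha> b. \<psi> (?ms ! b + \<alpha>)"
      have cond: "(\<Sum>b<N. L i b * ?v \<alpha> b) = 0" if "i \<in> I" "\<alpha> \<in> mons n l" for i \<alpha>
      proof -
        have "(\<Sum>b<N. L i b * ?v \<alpha> b) = (\<Sum>b<N. L i b * (\<Sum>\<gamma>\<in>F. if ?ms ! b + \<alpha> = \<gamma> then \<phi> \<gamma> else 0))"
          using F by (simp add: \<psi>_def)
        also have "\<dots> = (\<Sum>\<gamma>\<in>F. (\<Sum>b<N. L i b * (if ?ms ! b + \<alpha> = \<gamma> then 1 else 0)) * \<phi> \<gamma>)"
          unfolding sum_distrib_left sum_distrib_right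
          by (subst sum.swap) (intro sum.cong refl, simp)
        finally show ?thesis using \<phi>[OF that] by simp
      qed
      have hf: "mixed_form (\<lambda>\<beta>. \<psi> (\<beta> + \<alpha>)) M = matrix_form A N (?v \<alpha>)" for \<alpha>
        unfolding A_def N_def by (rule mixed_form_eq_matrix_form[OF M(1,3)])
      have "mixed_form (\<lambda>\<beta>. \<psi> (\<beta> + \<alpha>)) M \<le> 0" if "\<alpha> \<in> mons n l" for \<alpha>
        using nonpos[OF cond[OF _ that]] unfolding hf by (auto simp: less_eq_complex_def)
      from mixed_form_mult_norm_sq_power[of n l \<psi> M, OF this] sum_of_squared_norms_mixed_form_nonneg[OF sos, of \<psi>]
      have zero: "matrix_form A N (?v \<alpha>) = 0" if "\<alpha> \<in> mons n l" for \<alpha>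
        using that by (auto simp flip: hf)
      have Av: "(\<Sum>b<N. A $$ (a, b) * ?v \<alpha> b) = 0" if "\<alpha> \<in> mons n l" "a < N" for \<alpha> a
        using nonpos[OF cond[OF _ that(1)]] zero[OF that(1)] that(2) by blast
      \<comment> \<open>\<open>\<gamma>\<close> is the trailing monomial of a row combination of \<open>A\<close> shifted by some \<open>\<alpha>\<close>;
        all other monomials of that shifted row lie above \<open>\<gamma>\<close>, where \<open>\<psi>\<close> vanishes.\<close>
      define \<gamma> where "\<gamma> = Max {\<gamma> \<in> F. \<psi> \<gamma> \<noteq> 0}"
      have "\<gamma>0 \<in> {\<gamma> \<in> F. \<psi> \<gamma> \<noteq> 0}" using \<gamma>0 by (simp add: \<psi>_def)
      then have \<gamma>: "\<gamma> \<in> F" "\<psi> \<gamma> \<noteq> 0"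
        using Max_in[of "{\<gamma> \<in> F. \<psi> \<gamma> \<noteq> 0}"] F unfolding \<gamma>_def by auto
      have max: "\<psi> \<gamma>' = 0" if "\<gamma> < \<gamma>'" for \<gamma>'
        using that Max_ge[of "{\<gamma> \<in> F. \<psi> \<gamma> \<noteq> 0}" \<gamma>'] F unfolding \<gamma>_def
        by (cases "\<gamma>' \<in> F") (auto simp: \<psi>_def not_le[symmetric])
      obtain \<beta> \<alpha> where "\<beta> \<in> E" and \<alpha>: "\<alpha> \<in> mons n l" and \<gamma>_eq: "\<gamma> = \<beta> + \<alpha>"
        using shadow_pow_decompose[OF \<gamma>(1)[unfolded F_def]] by blast
      then obtain b where b: "b \<in> B" "\<gamma> = ?ms ! b + \<alpha>" by (auto simp: E_def)
      then obtain w where bN: "b < N" and w: "(\<Sum>a<N. w a * A $$ (a, b)) \<noteq> 0"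
        "\<And>b'. b' < b \<Longrightarrow> (\<Sum>a<N. w a * A $$ (a, b')) = 0" by (auto simp: B_def)
      have "0 = (\<Sum>a<N. w a * (\<Sum>b'<N. A $$ (a, b') * ?v \<alpha> b'))" using Av[OF \<alpha>] by simp
      also have "\<dots> = (\<Sum>b'<N. (\<Sum>a<N. w a * A $$ (a, b')) * ?v \<alpha> b')"
        unfolding sum_distrib_left sum_distrib_right by (subst sum.swap) (simp add: mult.assoc)
      also have "\<dots> = (\<Sum>b'\<in>{b}. (\<Sum>a<N. w a * A $$ (a, b')) * ?v \<alpha> b')"
      proof (rule sum.mono_neutral_right)
        show "\<forall>b'\<in>{..<N} - {b}. (\<Sum>a<N. w a * A $$ (a, b')) * ?v \<alpha> b' = 0"
        proof
          fix b' assume b': "b' \<in> {..<N} - {b}"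
          show "(\<Sum>a<N. w a * A $$ (a, b')) * ?v \<alpha> b' = 0"
          proof (cases "b' < b")
            case False
            then have "?ms ! b < ?ms ! b'" using b' by (intro less_ms) auto
            \<comment> \<open>The order on monomials is compatible with multiplication.\<close>
            then have "\<gamma> < ?ms ! b' + \<alpha>" unfolding b(2) by (rule add_strict_right_mono)
            then show ?thesis by (simp add: max)
          qed (simp add: w(2))
        qed
      qed (use bN in auto)
      finally show False using w(1) \<gamma>(2) b(2) by simp
    qed
    then show ?thesis using E cardE unfolding F_def by blast
  qed
qed

theorem corollary4p5:
  fixes n l d p q :: nat and M :: mixed_poly
  assumes "n \<ge> 2" and "l \<ge> 1"
    and "mixed_poly_on n M" and "M \<noteq> 0"
    and "hermitian_poly M" and "bihomogeneous d M"
    and "signature n d M = (p, q)"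
    and "sum_of_squared_norms n (M * norm_sq_poly n ^ l)"
  shows "int q \<le> int p * int ((n - 1 + l) choose l) - int p
                   - macaulay_shift p (n - 1) (-1) (int l - 1) \<and>
         (l = 1 \<longrightarrow> int q \<le> int p * (int n - 1) - macaulay_shift p (n - 1) (-1) 0)"
proof -
  obtain N k where n: "n = Suc N" "0 < N" and l: "l = Suc k"
    using assms(1,2) by (cases n; cases l) auto
  obtain E where E: "E \<subseteq> mons n d" "p + q \<le> card E" and growth: "card ((shadow n ^^ l) E) \<le> p * card (mons n l)"
    using rank_growth_bound[OF assms(3,5,6,8,7)] by blast
  have "p * card (mons n l) \<le> p * ((n - 1 + l) choose l)"
    using card_mons_le[of N l] n by simp
  with growth have growth': "card ((shadow n ^^ l) E) \<le> p * ((n - 1 + l) choose l)" by (rule order_trans)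
  have main: "int q \<le> int p * int ((n - 1 + l) choose l) - int p - macaulay_shift p (n - 1) (-1) (int l - 1)"
  proof (cases "p = 0")
    case True
    have "card E = 0"
    proof (rule ccontr)
      assume "card E \<noteq> 0"
      \<comment> \<open>The identity sequence encodes zero, as \<open>j choose Suc j = 0\<close>; so
        a nonempty \<open>E\<close> would have nonempty shadows.\<close>
      then have "(\<Sum>j<N. id j choose Suc j) < card E" by simp
      then have "card E \<le> card ((shadow n ^^ l) E)"
        using card_shadow_pow_ge[of id E N d l] E n by (simp add: strict_mono_def)
      then show False using growth' True \<open>card E \<noteq> 0\<close> by simp
    qed
    then show ?thesis using True E by (simp add: macaulay_shift_def)
  next
    case False
    then obtain c where c: "strict_mono c" "(\<Sum>j<N. c j choose Suc j) < p"
      "macaulay_shift p N (-1) (int k) = int (\<Sum>j<N. (c j + k) choose j)"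
      using macaulay_shift_combinadic[of p N k] n by auto
    have "card E + (\<Sum>j<N. (c j + k) choose j) \<le> card ((shadow (Suc N) ^^ Suc k) E)"
      using c E n by (intro card_shadow_pow_Suc_ge[of c E N d]) auto
    then have "p + q + (\<Sum>j<N. (c j + k) choose j) \<le> p * ((n - 1 + l) choose l)"
      using E(2) growth' unfolding n l by linarith
    then have "int (p + q + (\<Sum>j<N. (c j + k) choose j)) \<le> int (p * ((n - 1 + l) choose l))"
      by (simp only: of_nat_le_iff)
    then show ?thesis using c(3) n l by simp
  qed
  moreover have "int q \<le> int p * (int n - 1) - macaulay_shift p (n - 1) (-1) 0" if "l = 1"
    using main that n by (simp add: algebra_simps)
  ultimately show ?thesis by blast
qed

end
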